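(* Let $f\in L^2(\mathbb{R}^{p,q},Cl(p,q))$ and put $F=\int_{\mathbb{R}^{p,q}}|f(x)|^2\,d^nx$. Let $a,b\in\mathbb{R}^{p,q}$ be arbitrary constant vectors. Then $$\int_{\mathbb{R}^{p,q}}(a\cdot x)^2|f(x)|^2\,d^nx\;\cdot\;\frac{1}{(2\pi)^n}\int_{\mathbb{R}^{p,q}}(b\cdot w)^2\,|\mathcal{F}^i\{f\}(w)|^2\,d^nw\;\geq\;(a\cdot\widetilde{b})^2\,\frac14\,F^2 .$$
   Context: Let $n=p+q\ge 1$. $Cl(p,q)$ is the real associative unital Clifford algebra generated by $e_1,\dots,e_n$ with $e_ke_l+e_le_k=2\epsilon_k\delta_{k,l}$, where $\epsilon_k=+1$ for $1\le k\le p$ and $\epsilon_k=-1$ for $p+1\le k\le n$. It has the basis $e_A=e_{i_1}\cdots e_{i_k}$, $A=\{i_1<\cdots<i_k\}\subseteq\{1,\dots,n\}$, $e_\emptyset=1$; elements are written $M=\sum_A M_Ae_A$ with $M_A\in\mathbb{R}$, and $\langle M\rangle_k$ denotes the grade-$k$ part. The scalar product is $M\ast N=\langle MN\rangle_0$. The principal reverse is $\widetilde{M}=\sum_{k=0}^n(-1)^{k(k-1)/2}\,\overline{\langle M\rangle_k}$, where the bar is linear with $\overline{e_{i_1}\cdots e_{i_k}}=\epsilon_{i_1}e_{i_1}\cdots\epsilon_{i_k}e_{i_k}$; one has $M\ast\widetilde N=\sum_AM_AN_A$, and the modulus is $|M|^2=M\ast\widetilde M=\sum_AM_A^2$. Vectors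 $x\in\mathbb{R}^{p,q}$ are identified with $x=\sum_{l}x_le^l=\sum_l x^le_l$, where $e^l=\epsilon_le_l$ (so $x^l=\epsilon_lx_l$). For vectors, $a\cdot b=a\ast b=\sum_l a^lb_l$; hence $a\cdot\widetilde b=\sum_la^lb^l$ and $|x|^2=\sum_l x_l^2$. $d^nx=dx_1\cdots dx_n$ is Lebesgue measure. $L^2(\mathbb{R}^{p,q},Cl(p,q))$ is the space of (measurable) $f=\sum_Af_Ae_A:\mathbb{R}^{p,q}\to Cl(p,q)$, $f_A$ real-valued, with $\int|f(x)|^2d^nx<\infty$. Fix $i\in Cl(p,q)$ with $i^2=-1$ and $\widetilde i=-i$. For $f\in L^1(\mathbb{R}^{p,q},Cl(p,q))$ the Clifford Fourier transform with respect to $i$ is $$\mathcal{F}^i\{f\}(w)=\int_{\mathbb{R}^{p,q}}f(x)e^{-iu(x,w)}\,d^nx,\qquad u(x,w)=x\ast\widetilde w=\sum_{l=1}^nx_lw_l,$$ where $e^{-i\theta}=\cos\theta-i\sin\theta$ for $\theta\in\mathbb{R}$; it is extended to $L^2$ by continuity in the usual Plancherel sense. Integrals of nonnegative functions take values in $[0,\infty]$, with $0\cdot\infty=0$. *)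

theory Defs
  imports "HOL-Analysis.Analysis"
begin

text \<open>
  The generators are indexed by a finite linearly ordered type \<open>'n\<close>, so that \<open>n = CARD('n)\<close>; its
  elements, listed in increasing order, play the role of \<open>1, \<dots>, n\<close>. An element \<open>M\<close> of the Clifford
  algebra is the family of its coordinates \<open>M $ A\<close> with respect to the basis \<open>e\<^sub>A\<close>, where \<open>A\<close> is a
  subset of \<open>'n\<close>. The product is \<open>cl_mult\<close> below; the operation \<open>*\<close> that the library provides on
  this type is componentwise and is not the Clifford product.
\<close>

type_synonym 'n clifford = "(real, 'n set) vec"
type_synonym 'n rvec = "(real, 'n) vec"


section \<open>The algebra\<close>

definition cl_eps :: "nat \<Rightarrow> 'n::{finite,linorder} \<Rightarrow> real" where
  "cl_eps p k = (if card {j. j < k} < p then 1 else -1)"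

definition cl_basis :: "'n::{finite,linorder} set \<Rightarrow> 'n clifford" where
  "cl_basis A = axis A 1"

definition cl_one :: "'n::{finite,linorder} clifford" where
  "cl_one = cl_basis {}"

text \<open>
  The structure constants: \<open>e\<^sub>A e\<^sub>B = cl_sign p A B e\<^sub>C\<close>, where \<open>C\<close> is the symmetric difference. Sorting
  the word \<open>e\<^sub>A e\<^sub>B\<close> costs one sign for each pair in the wrong order, and then every generator
  occurring twice contributes its square.
\<close>

definition cl_sign :: "nat \<Rightarrow> 'n::{finite,linorder} set \<Rightarrow> 'n set \<Rightarrow> real" where
  "cl_sign p A B = (-1) ^ card {(i, j). i \<in> A \<and> j \<in> B \<and> j < i} * (\<Prod>k\<in>A \<inter> B. cl_eps p k)"

definition cl_mult ::
    "nat \<Rightarrow> 'n::{finite,linorder} clifford \<Rightarrow> 'n clifford \<Rightarrow> 'n clifford" where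
  "cl_mult p M N =
     (\<Sum>A\<in>UNIV. \<Sum>B\<in>UNIV. (M $ A * N $ B * cl_sign p A B) *\<^sub>R cl_basis (sym_diff A B))"

definition cl_grade :: "nat \<Rightarrow> 'n::{finite,linorder} clifford \<Rightarrow> 'n clifford" where
  "cl_grade k M = (\<chi> A. if card A = k then M $ A else 0)"

definition cl_scalar :: "nat \<Rightarrow> 'n::{finite,linorder} clifford \<Rightarrow> 'n clifford \<Rightarrow> real" where
  "cl_scalar p M N = cl_grade 0 (cl_mult p M N) $ {}"

definition cl_bar :: "nat \<Rightarrow> 'n::{finite,linorder} clifford \<Rightarrow> 'n clifford" where
  "cl_bar p M = (\<Sum>A\<in>UNIV. (M $ A * (\<Prod>k\<in>A. cl_eps p k)) *\<^sub>R cl_basis A)"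

definition cl_rev :: "nat \<Rightarrow> 'n::{finite,linorder} clifford \<Rightarrow> 'n clifford" where
  "cl_rev p M = (\<Sum>k\<le>CARD('n). (-1) ^ (k * (k - 1) div 2) *\<^sub>R cl_bar p (cl_grade k M))"

definition cl_modulus :: "nat \<Rightarrow> 'n::{finite,linorder} clifford \<Rightarrow> real" where
  "cl_modulus p M = sqrt (cl_scalar p M (cl_rev p M))"

text \<open>
  A vector is given by its lower coordinates \<open>x $ l = x\<^sub>l\<close>, the coefficients of
  \<open>e\<^sup>l = cl_eps p l e\<^sub>l\<close>.
\<close>

definition cl_vec :: "nat \<Rightarrow> 'n::{finite,linorder} rvec \<Rightarrow> 'n clifford" where
  "cl_vec p x = (\<Sum>l\<in>UNIV. (x $ l) *\<^sub>R (cl_eps p l *\<^sub>R cl_basis {l}))"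


section \<open>The model is the Clifford algebra\<close>

lemma cl_eps_square [simp]: "cl_eps p k * cl_eps p k = 1"
  by (simp add: cl_eps_def)

lemma cl_basis_nth: "cl_basis A $ B = (if B = A then 1 else 0)"
  by (simp add: cl_basis_def axis_def)

lemma cl_expand: "M = (\<Sum>A\<in>UNIV. M $ A *\<^sub>R cl_basis A)"
  by (simp add: vec_eq_iff cl_basis_nth if_distrib[of "(*) _"] cong: if_cong)

lemma cl_mult_basis:
  "cl_mult p (cl_basis A) (cl_basis B) = cl_sign p A B *\<^sub>R cl_basis (sym_diff A B)"
proof -
  have "cl_mult p (cl_basis A) (cl_basis B) =
    (\<Sum>A'\<in>UNIV. \<Sum>B'\<in>UNIV. if B' = B then (if A' = A then
       cl_sign p A B *\<^sub>R cl_basis (sym_diff A B) else 0) else 0)"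
    unfolding cl_mult_def by (intro sum.cong refl) (auto simp: cl_basis_nth)
  then show ?thesis by simp
qed

lemma bilinear_cl_mult: "bilinear (cl_mult p)"
  unfolding bilinear_def
  by (auto intro!: linearI simp: cl_mult_def algebra_simps sum.distrib scaleR_sum_right)

lemma cl_sign_prod:
  "cl_sign p A B = (\<Prod>i\<in>UNIV. \<Prod>j\<in>UNIV. if i \<in> A \<and> j \<in> B \<and> j < i then -1 else 1) *
     (\<Prod>k\<in>UNIV. if k \<in> A \<and> k \<in> B then cl_eps p k else 1)"
proof -
  have "(-1) ^ card {(i, j). i \<in> A \<and> j \<in> B \<and> j < i} =
      (\<Prod>(i,j)\<in>UNIV. if i \<in> A \<and> j \<in> B \<and> j < i then -1 else (1::real))"
  proof -
    have "(\<Prod>(i,j)\<in>UNIV. if i \<in> A \<and> j \<in> B \<and> j < i then -1 else (1::real)) =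
       (\<Prod>z\<in>{(i, j). i \<in> A \<and> j \<in> B \<and> j < i}. -1)"
      by (intro prod.mono_neutral_cong_right) (auto split: if_splits)
    then show ?thesis by simp
  qed
  moreover have "(\<Prod>k\<in>A \<inter> B. cl_eps p k) = (\<Prod>k\<in>UNIV. if k \<in> A \<and> k \<in> B then cl_eps p k else 1)"
    by (intro prod.mono_neutral_cong_left) auto
  ultimately show ?thesis
    by (simp add: cl_sign_def prod.cartesian_product)
qed

lemma cl_sign_cocycle:
  "cl_sign p A B * cl_sign p (sym_diff A B) C = cl_sign p A (sym_diff B C) * cl_sign p B C"
proof -
  define s :: "'a set \<Rightarrow> 'a set \<Rightarrow> real" where
    "s = (\<lambda>A B. \<Prod>i\<in>UNIV. \<Prod>j\<in>UNIV. if i \<in> A \<and> j \<in> B \<and> j < i then -1 else 1)"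
  define t :: "'a set \<Rightarrow> 'a set \<Rightarrow> real" where
    "t = (\<lambda>A B. \<Prod>k\<in>UNIV. if k \<in> A \<and> k \<in> B then cl_eps p k else 1)"
  have 1: "s A B * s (sym_diff A B) C = s A (sym_diff B C) * s B C"
    unfolding s_def prod.distrib[symmetric] by (intro prod.cong refl) auto
  have 2: "t A B * t (sym_diff A B) C = t A (sym_diff B C) * t B C"
    unfolding t_def prod.distrib[symmetric]
  proof (rule prod.cong)
    fix k
    show "(if k \<in> A \<and> k \<in> B then cl_eps p k else 1) *
        (if k \<in> sym_diff A B \<and> k \<in> C then cl_eps p k else 1) =
        (if k \<in> A \<and> k \<in> sym_diff B C then cl_eps p k else 1) *
        (if k \<in> B \<and> k \<in> C then cl_eps p k else 1)"
      by (cases "k \<in> A"; cases "k \<in> B"; cases "k \<in> C") simp_all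
  qed simp
  have "cl_sign p A B = s A B * t A B" for A B
    by (simp add: cl_sign_prod s_def t_def)
  then show ?thesis using arg_cong2[OF 1 2, of "(*)"] by (simp add: mult_ac)
qed

lemma linear_cl_mult_left: "linear (\<lambda>M. cl_mult p M N)"
  and linear_cl_mult_right: "linear (cl_mult p M)"
  using bilinear_cl_mult[of p] by (auto simp: bilinear_def)

lemma cl_linear_eqI:
  fixes f g :: "'n::{finite,linorder} clifford \<Rightarrow> 'b::real_vector"
  assumes "linear f" "linear g" "\<And>A. f (cl_basis A) = g (cl_basis A)"
  shows "f M = g M"
proof -
  have "f (\<Sum>A\<in>UNIV. M $ A *\<^sub>R cl_basis A) = g (\<Sum>A\<in>UNIV. M $ A *\<^sub>R cl_basis A)"
    by (simp add: linear_sum[OF assms(1)] linear_sum[OF assms(2)]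
        linear_scale[OF assms(1)] linear_scale[OF assms(2)] assms(3))
  then show ?thesis by (simp only: cl_expand[symmetric])
qed

lemma cl_mult_one_left: "cl_mult p cl_one M = M"
proof (rule cl_linear_eqI[where g = "\<lambda>M. M"])
  show "cl_mult p cl_one (cl_basis A) = cl_basis A" for A
    by (simp add: cl_one_def cl_mult_basis cl_sign_def)
qed (auto intro: linear_cl_mult_right linear_ident)

lemma cl_mult_one_right: "cl_mult p M cl_one = M"
proof (rule cl_linear_eqI[where f = "\<lambda>M. cl_mult p M cl_one" and g = "\<lambda>M. M"])
  show "cl_mult p (cl_basis A) cl_one = cl_basis A" for A
    by (simp add: cl_one_def cl_mult_basis cl_sign_def)
qed (auto intro: linear_cl_mult_left linear_ident)

lemma cl_mult_assoc: "cl_mult p (cl_mult p L M) N = cl_mult p L (cl_mult p M N)"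
proof -
  note lin = linear_compose[unfolded o_def]
  have sd: "sym_diff (sym_diff A B) C = sym_diff A (sym_diff B C)" for A B C :: "'a set"
    by auto
  have 1: "cl_mult p (cl_mult p (cl_basis A) (cl_basis B)) (cl_basis C) =
      cl_mult p (cl_basis A) (cl_mult p (cl_basis B) (cl_basis C))" for A B C :: "'a set"
    by (simp add: cl_mult_basis linear_scale[OF linear_cl_mult_left]
        linear_scale[OF linear_cl_mult_right] cl_sign_cocycle sd mult.commute)
  have 2: "cl_mult p (cl_mult p (cl_basis A) (cl_basis B)) N =
      cl_mult p (cl_basis A) (cl_mult p (cl_basis B) N)" for A B
    by (rule cl_linear_eqI[where f = "cl_mult p (cl_mult p (cl_basis A) (cl_basis B))"
          and g = "\<lambda>N. cl_mult p (cl_basis A) (cl_mult p (cl_basis B) N)"])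
       (auto intro: lin linear_cl_mult_left linear_cl_mult_right simp: 1)
  have 3: "cl_mult p (cl_mult p (cl_basis A) M) N =
      cl_mult p (cl_basis A) (cl_mult p M N)" for A
    by (rule cl_linear_eqI[where f = "\<lambda>M. cl_mult p (cl_mult p (cl_basis A) M) N"
          and g = "\<lambda>M. cl_mult p (cl_basis A) (cl_mult p M N)"])
       (auto intro: lin[OF linear_cl_mult_right linear_cl_mult_left]
          lin[OF linear_cl_mult_left linear_cl_mult_right] simp: 2)
  show ?thesis
    by (rule cl_linear_eqI[where f = "\<lambda>L. cl_mult p (cl_mult p L M) N"
          and g = "\<lambda>L. cl_mult p L (cl_mult p M N)"])
       (auto intro: lin[OF linear_cl_mult_left linear_cl_mult_left] linear_cl_mult_left simp: 3)
qed

lemma cl_sign_singletons: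
  "cl_sign p {k} {l} = (if l < k then -1 else 1) * (if k = l then cl_eps p k else 1)"
proof -
  have "{(i, j). i \<in> {k} \<and> j \<in> {l} \<and> j < i} = (if l < k then {(k, l)} else {})"
    by auto
  then show ?thesis by (auto simp: cl_sign_def)
qed

lemma cl_generators:
  "cl_mult p (cl_basis {k}) (cl_basis {l}) + cl_mult p (cl_basis {l}) (cl_basis {k}) =
     (2 * (if k = l then cl_eps p k else 0)) *\<^sub>R cl_one"
proof (cases "k = l")
  case True
  have "cl_mult p (cl_basis {k}) (cl_basis {k}) = cl_eps p k *\<^sub>R cl_one"
    by (simp add: cl_mult_basis cl_sign_singletons cl_one_def)
  then show ?thesis
    by (simp only: True refl if_True mult_2 scaleR_add_left simp_thms)
next
  case False
  have "sym_diff {k} {l} = sym_diff {l} {k}" by auto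
  moreover have "cl_sign p {k} {l} + cl_sign p {l} {k} = 0"
    using False by (auto simp: cl_sign_singletons)
  ultimately show ?thesis
    using False by (simp add: cl_mult_basis flip: scaleR_add_left)
qed

lemma cl_basis_eq_product:
  "cl_basis A = foldr (\<lambda>k. cl_mult p (cl_basis {k})) (sorted_list_of_set A) cl_one"
proof -
  have "cl_basis (set ks) = foldr (\<lambda>k. cl_mult p (cl_basis {k})) ks cl_one"
    if "sorted_wrt (<) ks" for ks :: "'a list"
    using that
  proof (induction ks)
    case Nil
    then show ?case by (simp add: cl_one_def)
  next
    case (Cons k ks)
    have "{(i, j). i \<in> {k} \<and> j \<in> set ks \<and> j < i} = {}" "{k} \<inter> set ks = {}"
      using Cons.prems by (auto dest: order.strict_trans)
    then have "cl_sign p {k} (set ks) = 1"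
      unfolding cl_sign_def by (simp only: card.empty power_0 prod.empty mult_1)
    moreover have "sym_diff {k} (set ks) = set (k # ks)"
      using \<open>{k} \<inter> set ks = {}\<close> by auto
    ultimately have "cl_mult p (cl_basis {k}) (cl_basis (set ks)) = cl_basis (set (k # ks))"
      by (simp only: cl_mult_basis scaleR_one)
    then show ?case
      using Cons by simp
  qed
  from this[of "sorted_list_of_set A"] show ?thesis by simp
qed

lemma cl_scalar_coords: "cl_scalar p M N = (\<Sum>A\<in>UNIV. M $ A * N $ A * cl_sign p A A)"
proof -
  have "({} = sym_diff A B) = (B = A)" for A B :: "'a set"
    by auto
  then show ?thesis
    by (simp add: cl_scalar_def cl_grade_def cl_mult_def cl_basis_nth if_distrib[of "(*) _"]
        del: Un_empty cong: if_cong)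
qed

lemma cl_scalar_rev: "cl_scalar p M (cl_rev p N) = (\<Sum>A\<in>UNIV. M $ A * N $ A)"
proof -
  have card_inv: "card {(i, j). i \<in> A \<and> j \<in> A \<and> j < i} = card A * (card A - 1) div 2"
    for A :: "'a set"
  proof -
    have "card {(i, j). i \<in> A \<and> j \<in> A \<and> j < i} = card {(i, j). i \<in> A \<and> j \<in> A \<and> i < j}"
      by (rule bij_betw_same_card[of prod.swap]) (auto simp: bij_betw_def inj_on_def)
    moreover have "{(i, j). i \<in> A \<and> j \<in> A \<and> i \<noteq> j} =
        {(i, j). i \<in> A \<and> j \<in> A \<and> j < i} \<union> {(i, j). i \<in> A \<and> j \<in> A \<and> i < j}"
      by auto
    moreover have "{(i, j). i \<in> A \<and> j \<in> A \<and> i \<noteq> j} = A \<times> A - (\<lambda>i. (i, i)) ` A"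
      by auto
    moreover have "card (A \<times> A - (\<lambda>i. (i, i)) ` A) = card A * card A - card A"
      by (subst card_Diff_subset) (auto simp: card_image inj_on_def card_cartesian_product)
    moreover have "card ({(i, j). i \<in> A \<and> j \<in> A \<and> j < i} \<union> {(i, j). i \<in> A \<and> j \<in> A \<and> i < j}) =
      card {(i, j). i \<in> A \<and> j \<in> A \<and> j < i} + card {(i, j). i \<in> A \<and> j \<in> A \<and> i < j}"
      by (rule card_Un_disjoint) auto
    ultimately have "card A * card A - card A = 2 * card {(i, j). i \<in> A \<and> j \<in> A \<and> j < i}"
      by simp
    then show ?thesis by (simp add: algebra_simps)
  qed
  have bar: "cl_bar p M $ A = M $ A * (\<Prod>k\<in>A. cl_eps p k)" for M :: "'a clifford" and A
    by (simp add: cl_bar_def cl_basis_nth if_distrib[of "(*) _"] cong: if_cong)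
  have rev: "cl_rev p N $ A =
      (-1) ^ (card A * (card A - 1) div 2) * (N $ A * (\<Prod>k\<in>A. cl_eps p k))" for A
  proof -
    have "cl_rev p N $ A = (\<Sum>k\<le>CARD('a). if k = card A then
        (-1) ^ (card A * (card A - 1) div 2) * (N $ A * (\<Prod>k\<in>A. cl_eps p k)) else 0)"
      unfolding cl_rev_def sum_component
      by (intro sum.cong refl) (auto simp: bar cl_grade_def)
    also have "card A \<le> CARD('a)" by (simp add: card_mono)
    ultimately show ?thesis by simp
  qed
  have sq: "cl_sign p A A * ((-1) ^ (card A * (card A - 1) div 2) * (\<Prod>k\<in>A. cl_eps p k)) = 1"
    for A :: "'a set"
  proof -
    have "(\<Prod>k\<in>A. cl_eps p k) * (\<Prod>k\<in>A. cl_eps p k) = 1"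
      by (simp flip: prod.distrib)
    moreover have "(-1) ^ m * (-1) ^ m = (1::real)" for m :: nat
      by (simp flip: power_add)
    moreover have "(s * e) * (s * e) = (s * s) * (e * e)" for s e :: real
      by (simp add: mult_ac)
    ultimately show ?thesis
      unfolding cl_sign_def card_inv Int_absorb by (metis mult_1)
  qed
  have "cl_scalar p M (cl_rev p N) = (\<Sum>A\<in>UNIV. M $ A * N $ A * (cl_sign p A A *
      ((-1) ^ (card A * (card A - 1) div 2) * (\<Prod>k\<in>A. cl_eps p k))))"
    by (simp add: cl_scalar_coords rev mult_ac)
  then show ?thesis unfolding sq by simp
qed

lemma cl_modulus_eq_norm: "cl_modulus p M = norm M"
  by (simp add: cl_modulus_def cl_scalar_rev norm_vec_def L2_set_def power2_eq_square)

lemma cl_vec_nth: "cl_vec p x $ A = (\<Sum>l\<in>UNIV. if A = {l} then cl_eps p l * x $ l else 0)"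
  by (auto simp: cl_vec_def cl_basis_nth intro!: sum.cong)

lemma cl_vec_nth_singleton: "cl_vec p x $ {l} = cl_eps p l * x $ l"
  by (simp add: cl_vec_nth)

lemma sum_singletons:
  fixes h :: "'n::finite set \<Rightarrow> real"
  assumes "\<And>A. \<forall>l. A \<noteq> {l} \<Longrightarrow> h A = 0"
  shows "(\<Sum>A\<in>UNIV. h A) = (\<Sum>l\<in>UNIV. h {l})"
proof -
  have "(\<Sum>A\<in>UNIV. h A) = (\<Sum>A\<in>range (\<lambda>l. {l}). h A)"
    by (intro sum.mono_neutral_right) (auto intro!: assms)
  also have "\<dots> = (\<Sum>l\<in>UNIV. h {l})"
    by (subst sum.reindex) (auto simp: inj_on_def)
  finally show ?thesis .
qed

lemma cl_scalar_vec_rev: "cl_scalar p (cl_vec p x) (cl_rev p (cl_vec p w)) = (\<Sum>l\<in>UNIV. x $ l * w $ l)"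
proof -
  have "cl_scalar p (cl_vec p x) (cl_rev p (cl_vec p w)) =
      (\<Sum>l\<in>UNIV. cl_vec p x $ {l} * cl_vec p w $ {l})"
    unfolding cl_scalar_rev by (rule sum_singletons) (simp add: cl_vec_nth)
  also have "\<dots> = (\<Sum>l\<in>UNIV. (cl_eps p l * cl_eps p l) * (x $ l * w $ l))"
    by (simp only: cl_vec_nth_singleton mult_ac)
  finally show ?thesis unfolding cl_eps_square by simp
qed

lemma cl_scalar_vec: "cl_scalar p (cl_vec p a) (cl_vec p b) = (\<Sum>l\<in>UNIV. cl_eps p l * a $ l * b $ l)"
proof -
  have "cl_scalar p (cl_vec p a) (cl_vec p b) =
      (\<Sum>l\<in>UNIV. cl_vec p a $ {l} * cl_vec p b $ {l} * cl_sign p {l} {l})"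
    unfolding cl_scalar_coords by (rule sum_singletons) (simp add: cl_vec_nth)
  also have "\<dots> = (\<Sum>l\<in>UNIV. (cl_eps p l * cl_eps p l) * (cl_eps p l * a $ l * b $ l))"
    by (simp only: cl_vec_nth_singleton cl_sign_singletons less_irrefl if_True if_False refl mult_1)
       (simp only: mult_ac)
  finally show ?thesis unfolding cl_eps_square by simp
qed


section \<open>The Clifford Fourier transform\<close>

definition cl_L2 :: "nat \<Rightarrow> ('n rvec \<Rightarrow> 'n::{finite,linorder} clifford) set" where
  "cl_L2 p = {f. f \<in> borel_measurable lebesgue \<and>
     (\<integral>\<^sup>+x. ennreal ((cl_modulus p (f x))\<^sup>2) \<partial>lebesgue) < \<infinity>}"

definition cl_exp_neg :: "'n::{finite,linorder} clifford \<Rightarrow> real \<Rightarrow> 'n clifford" where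
  "cl_exp_neg i \<theta> = cos \<theta> *\<^sub>R cl_one - sin \<theta> *\<^sub>R i"

definition cl_fourier :: "nat \<Rightarrow> 'n::{finite,linorder} clifford \<Rightarrow>
    ('n rvec \<Rightarrow> 'n clifford) \<Rightarrow> 'n rvec \<Rightarrow> 'n clifford" where
  "cl_fourier p i f w =
     (\<integral>x. cl_mult p (f x) (cl_exp_neg i (cl_scalar p (cl_vec p x) (cl_rev p (cl_vec p w)))) \<partial>lebesgue)"

definition cl_L2_tendsto :: "nat \<Rightarrow> (nat \<Rightarrow> 'n rvec \<Rightarrow> 'n::{finite,linorder} clifford) \<Rightarrow>
    ('n rvec \<Rightarrow> 'n clifford) \<Rightarrow> bool" where
  "cl_L2_tendsto p h f \<longleftrightarrow>
     (\<lambda>m. \<integral>\<^sup>+x. ennreal ((cl_modulus p (h m x - f x))\<^sup>2) \<partial>lebesgue) \<longlonglongrightarrow> 0"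

text \<open>
  The continuous extension of \<open>cl_fourier p i\<close> from the integrable functions in \<open>cl_L2 p\<close> to all of
  \<open>cl_L2 p\<close>. The value is determined only up to a null set, hence the choice of a representative.
  Truncations of \<open>f\<close> to balls provide approximating sequences, and constant sequences show that on
  integrable functions both transforms agree almost everywhere.
\<close>

definition is_cl_fourier_L2 :: "nat \<Rightarrow> 'n::{finite,linorder} clifford \<Rightarrow>
    ('n rvec \<Rightarrow> 'n clifford) \<Rightarrow> ('n rvec \<Rightarrow> 'n clifford) \<Rightarrow> bool" where
  "is_cl_fourier_L2 p i f g \<longleftrightarrow> g \<in> cl_L2 p \<and>
     (\<forall>h. (\<forall>m. integrable lebesgue (h m) \<and> h m \<in> cl_L2 p) \<and> cl_L2_tendsto p h f \<longrightarrow>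
        cl_L2_tendsto p (\<lambda>m. cl_fourier p i (h m)) g)"

definition cl_fourier_L2 :: "nat \<Rightarrow> 'n::{finite,linorder} clifford \<Rightarrow>
    ('n rvec \<Rightarrow> 'n clifford) \<Rightarrow> 'n rvec \<Rightarrow> 'n clifford" where
  "cl_fourier_L2 p i f = (SOME g. is_cl_fourier_L2 p i f g)"

end

theory Submission
  imports Defs "HOL-Probability.Characteristic_Functions"
begin

text \<open>
  The coordinates identify \<open>Cl(p,q)\<close> with a Euclidean space whose norm is the modulus. Since
  \<open>i\<^sup>2 = -1\<close> and the principal reverse of \<open>i\<close> is \<open>- i\<close>, right multiplication \<open>J\<close> by \<open>i\<close> is linear,
  squares to \<open>-1\<close> and is skew for the inner product. So right multiplication by \<open>exp (- i \<theta>)\<close> is a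
  rotation \<open>rot \<theta>\<close>, and the Clifford Fourier transform is \<open>w \<mapsto> \<integral> rot (x \<bullet> w) (f x) dx\<close> on
  functions with values in a Euclidean space with an orthogonal complex structure. The two weights \<open>a \<cdot> x\<close> and \<open>b \<cdot> w\<close> become \<open>\<alpha> \<bullet> x\<close> and \<open>\<beta> \<bullet> w\<close>,
  where \<open>\<alpha>\<close> and \<open>\<beta>\<close> are \<open>a\<close> and \<open>b\<close> with signs \<open>\<epsilon>\<^sub>l\<close>; the signs cancel in \<open>\<alpha> \<bullet> \<beta>\<close>.

  The inequality itself needs no derivatives (\<open>uncertainty_from_shifts\<close>). Write \<open>F\<close> for the integral
  of \<open>|f|\<^sup>2\<close>, and \<open>A\<close>, \<open>B\<close> for the two factors on the left-hand side. Translating the integration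
  variable shows
  \<open>\<integral> (\<alpha> \<bullet> x) (|f x|\<^sup>2 - |f (x + t \<beta>)|\<^sup>2) dx = t (\<alpha> \<bullet> \<beta>) F\<close>. The integrand on the left is at
  most \<open>|f (x + t \<beta>) - f x|\<close> times \<open>|\<alpha> \<bullet> x| |f (x + t \<beta>) + f x|\<close>. On the Fourier side the shift
  becomes the rotation \<open>rot (- t (\<beta> \<bullet> w))\<close>, which moves a vector by at most \<open>t |\<beta> \<bullet> w|\<close> times its
  length, so the first factor has square integral at most \<open>t\<^sup>2 B\<close>; the square integral of the
  second one is bounded by a quantity that tends to \<open>4 A\<close> as \<open>t\<close> tends to 0. The Cauchy-Schwarz inequality, division by \<open>t\<close> and \<open>t \<rightarrow> 0\<close>
  give \<open>|\<alpha> \<bullet> \<beta>| F \<le> 2 \<surd>(A B)\<close>. When one factor is infinite and the other is zero, with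
  \<open>\<alpha>\<close> and \<open>\<beta>\<close> nonzero, the weights vanish only on null hyperplanes, which forces \<open>f = 0\<close> almost
  everywhere.

  The shift estimate for all of \<open>L\<^sup>2\<close>, and the very existence of the transform there, rest on the
  Plancherel theorem (\<open>plancherel\<close>) for integrable square integrable functions. It follows by
  inserting a Gaussian weight in the frequency integral, where Fubini's theorem and the Fourier
  transform of the Gaussian turn it into an average of \<open>\<integral> |h (x + s) - h x|\<^sup>2 dx\<close> over small \<open>s\<close>
  (\<open>smoothed_plancherel\<close>); translation is continuous in \<open>L\<^sup>2\<close> (\<open>translation_continuous\<close>), so this
  average disappears in the limit. Completeness of \<open>L\<^sup>2\<close> (\<open>square_integrable_complete\<close>) then yields
  the extension.
\<close>

section \<open>Square integrable functions\<close>

definition energy :: "('a::euclidean_space \<Rightarrow> 'v::euclidean_space) \<Rightarrow> ennreal" where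
  "energy f = (\<integral>\<^sup>+x. ennreal ((norm (f x))\<^sup>2) \<partial>lborel)"

text \<open>
  This is \<open>2 (u \<bullet> v) \<le> c |u|\<^sup>2 + |v|\<^sup>2 / c\<close>. Letting \<open>c\<close> tend to 0 gives the sharp constant in front of
  \<open>|u|\<^sup>2\<close>, so that integrals of squares can be compared in the limit, infinite values included,
  without the triangle inequality of \<open>L\<^sup>2\<close>.
\<close>

lemma norm_add_sq_le:
  fixes u v :: "'v::real_inner"
  assumes "c > 0"
  shows "(norm (u + v))\<^sup>2 \<le> (1 + c) * (norm u)\<^sup>2 + (1 + 1 / c) * (norm v)\<^sup>2"
proof -
  have "0 \<le> (norm (sqrt c *\<^sub>R u - (1 / sqrt c) *\<^sub>R v))\<^sup>2"
    by simp
  also have "\<dots> = c * (norm u)\<^sup>2 - 2 * (u \<bullet> v) + (norm v)\<^sup>2 / c"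
    using assms unfolding power2_norm_eq_inner
    by (simp add: inner_diff_left inner_diff_right inner_commute[of v u] algebra_simps)
  finally have "2 * (u \<bullet> v) \<le> c * (norm u)\<^sup>2 + (norm v)\<^sup>2 / c"
    by simp
  then show ?thesis
    by (simp add: power2_norm_eq_inner inner_add_left inner_add_right inner_commute[of v u] algebra_simps)
qed

lemma energy_add_le:
  assumes [measurable]: "f \<in> borel_measurable borel" "g \<in> borel_measurable borel" and "c > 0"
  shows "energy (\<lambda>x. f x + g x) \<le> ennreal (1 + c) * energy f + ennreal (1 + 1 / c) * energy g"
proof -
  have "energy (\<lambda>x. f x + g x) \<le>
      (\<integral>\<^sup>+x. ennreal (1 + c) * ennreal ((norm (f x))\<^sup>2) + ennreal (1 + 1 / c) * ennreal ((norm (g x))\<^sup>2) \<partial>lborel)"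
    unfolding energy_def using norm_add_sq_le[OF \<open>c > 0\<close>] \<open>c > 0\<close>
    by (intro nn_integral_mono) (simp add: ennreal_leI flip: ennreal_mult ennreal_plus)
  also have "\<dots> = ennreal (1 + c) * energy f + ennreal (1 + 1 / c) * energy g"
    unfolding energy_def by (subst nn_integral_add) (auto simp: nn_integral_cmult)
  finally show ?thesis .
qed

lemma energy_add_le2:
  assumes "f \<in> borel_measurable borel" "g \<in> borel_measurable borel"
  shows "energy (\<lambda>x. f x + g x) \<le> 2 * energy f + 2 * energy g"
  using energy_add_le[OF assms, of 1] by simp

lemma energy_mono:
  "(\<And>x. norm (f x) \<le> norm (g x)) \<Longrightarrow> energy f \<le> energy g"
  unfolding energy_def by (intro nn_integral_mono ennreal_leI power_mono) auto

lemma energy_cong_AE: "AE x in lborel. f x = g x \<Longrightarrow> energy f = energy g"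
  unfolding energy_def by (intro nn_integral_cong_AE) auto

lemma energy_minus_commute: "energy (\<lambda>x. f x - g x) = energy (\<lambda>x. g x - f x)"
  unfolding energy_def by (simp add: norm_minus_commute)

lemma energy_diff_le2:
  assumes [measurable]: "f \<in> borel_measurable borel" "g \<in> borel_measurable borel"
  shows "energy (\<lambda>x. f x - g x) \<le> 2 * energy f + 2 * energy g"
  using energy_add_le2[of f "\<lambda>x. - g x"] by (simp add: energy_def)

lemma energy_triangle2:
  assumes [measurable]: "f \<in> borel_measurable borel" "g \<in> borel_measurable borel"
     "h \<in> borel_measurable borel"
  shows "energy (\<lambda>x. f x - h x) \<le> 2 * energy (\<lambda>x. f x - g x) + 2 * energy (\<lambda>x. g x - h x)"
  using energy_add_le2[of "\<lambda>x. f x - g x" "\<lambda>x. g x - h x"] by simp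

lemma nn_integral_translate:
  fixes f :: "'a::euclidean_space \<Rightarrow> ennreal"
  assumes [measurable]: "f \<in> borel_measurable borel"
  shows "(\<integral>\<^sup>+x. f (x + s) \<partial>lborel) = (\<integral>\<^sup>+x. f x \<partial>lborel)"
proof -
  have "(\<integral>\<^sup>+x. f x \<partial>distr lborel borel ((+) s)) = (\<integral>\<^sup>+x. f (s + x) \<partial>lborel)"
    by (rule nn_integral_distr) auto
  then show ?thesis by (simp add: lborel_distr_plus add.commute)
qed

lemma energy_translate:
  assumes [measurable]: "f \<in> borel_measurable borel"
  shows "energy (\<lambda>x. f (x + s)) = energy f"
  unfolding energy_def by (rule nn_integral_translate[where f = "\<lambda>x. ennreal ((norm (f x))\<^sup>2)"]) auto

text \<open>
  An inequality between square integrals survives \<open>L\<^sup>2\<close> limits on both sides. Splitting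
  \<open>u = u\<^sub>m + (u - u\<^sub>m)\<close> and \<open>v\<^sub>m = v + (v\<^sub>m - v)\<close> by \<open>energy_add_le\<close> loses a factor \<open>1 + c\<close> each time; first
  \<open>m \<rightarrow> \<infinity>\<close>, then \<open>c \<rightarrow> 0\<close>.
\<close>

lemma energy_le_limit:
  fixes u :: "'a::euclidean_space \<Rightarrow> 'v::euclidean_space"
    and v :: "'b::euclidean_space \<Rightarrow> 'w::euclidean_space"
  assumes [measurable]: "\<And>m. u\<^sub>m m \<in> borel_measurable borel" "u \<in> borel_measurable borel"
    "\<And>m. v\<^sub>m m \<in> borel_measurable borel" "v \<in> borel_measurable borel"
    and le: "\<And>m. energy (u\<^sub>m m) \<le> C * energy (v\<^sub>m m)" and "C < \<infinity>"
    and u: "(\<lambda>m. energy (\<lambda>x. u\<^sub>m m x - u x)) \<longlonglongrightarrow> 0"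
    and v: "(\<lambda>m. energy (\<lambda>x. v\<^sub>m m x - v x)) \<longlonglongrightarrow> 0"
  shows "energy u \<le> C * energy v"
proof -
  have step: "energy u \<le> ennreal ((1 + c)\<^sup>2) * (C * energy v)" if "c > 0" for c
  proof -
    define K L where "K = ennreal (1 + c) * (C * ennreal (1 + 1 / c))" and "L = ennreal (1 + 1 / c)"
    have "energy u \<le> ennreal (1 + c) * (C * (ennreal (1 + c) * energy v)) +
        K * energy (\<lambda>x. v\<^sub>m m x - v x) + L * energy (\<lambda>x. u\<^sub>m m x - u x)" for m
    proof -
      have "energy u \<le> ennreal (1 + c) * energy (u\<^sub>m m) + L * energy (\<lambda>x. u x - u\<^sub>m m x)"
        using energy_add_le[of "u\<^sub>m m" "\<lambda>x. u x - u\<^sub>m m x" c] \<open>c > 0\<close> by (simp add: L_def)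
      also have "\<dots> \<le> ennreal (1 + c) * (C * energy (v\<^sub>m m)) + L * energy (\<lambda>x. u\<^sub>m m x - u x)"
        by (intro add_mono mult_left_mono le) (auto simp: energy_minus_commute)
      also have "energy (v\<^sub>m m) \<le> ennreal (1 + c) * energy v + ennreal (1 + 1 / c) * energy (\<lambda>x. v\<^sub>m m x - v x)"
        using energy_add_le[of v "\<lambda>x. v\<^sub>m m x - v x" c] \<open>c > 0\<close> by simp
      finally show ?thesis
        by (simp add: K_def distrib_left mult.assoc add_mono mult_left_mono)
    qed
    moreover have "(\<lambda>m. ennreal (1 + c) * (C * (ennreal (1 + c) * energy v)) +
        K * energy (\<lambda>x. v\<^sub>m m x - v x) + L * energy (\<lambda>x. u\<^sub>m m x - u x)) \<longlonglongrightarrow>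
        ennreal (1 + c) * (C * (ennreal (1 + c) * energy v)) + K * 0 + L * 0"
      using \<open>C < \<infinity>\<close>
      by (intro tendsto_add tendsto_const ennreal_tendsto_cmult u v)
        (auto simp: K_def L_def ennreal_mult_less_top)
    ultimately have "energy u \<le> ennreal (1 + c) * (C * (ennreal (1 + c) * energy v)) + K * 0 + L * 0"
      by (intro tendsto_lowerbound[of _ _ sequentially]) auto
    also have "\<dots> = ennreal ((1 + c)\<^sup>2) * (C * energy v)"
      using \<open>c > 0\<close> by (simp add: power2_eq_square ennreal_mult mult_ac)
    finally show ?thesis .
  qed
  show ?thesis
  proof (cases "C * energy v = \<infinity>")
    case False
    have "(\<lambda>m. C * energy v * ennreal ((1 + 1 / real (Suc m))\<^sup>2)) \<longlonglongrightarrow> C * energy v * ennreal ((1 + 0)\<^sup>2)"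
      using False LIMSEQ_Suc[OF lim_1_over_n, where ?'a1 = real]
      by (intro ennreal_tendsto_cmult tendsto_ennrealI tendsto_intros) auto
    moreover have "energy u \<le> C * energy v * ennreal ((1 + 1 / real (Suc m))\<^sup>2)" for m
      using step[of "1 / real (Suc m)"] by (simp add: mult.commute)
    ultimately show ?thesis
      by (intro tendsto_lowerbound[of "\<lambda>m. C * energy v * ennreal ((1 + 1 / real (Suc m))\<^sup>2)" _ sequentially]) auto
  qed auto
qed

text \<open>
  The Riesz-Fischer theorem for sequences with a geometric Cauchy rate. The rate leaves room for the
  weights \<open>2 ^ k\<close>: the series of \<open>2 ^ k |u (k + 1) - u k|\<^sup>2\<close> still has a finite integral, hence
  converges almost everywhere, so the increments decay geometrically at almost every point and
  \<open>u k\<close> converges there. Fatou's lemma bounds the distance to the limit.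
\<close>

lemma square_integrable_complete:
  fixes u :: "nat \<Rightarrow> 'a::euclidean_space \<Rightarrow> 'v::euclidean_space"
  assumes [measurable]: "\<And>k. u k \<in> borel_measurable borel"
    and C: "C < \<infinity>" "\<And>j k. k \<le> j \<Longrightarrow> energy (\<lambda>x. u j x - u k x) \<le> C * ennreal ((1/8) ^ k)"
  shows "\<exists>g\<in>borel_measurable borel. (\<lambda>k. energy (\<lambda>x. u k x - g x)) \<longlonglongrightarrow> 0"
proof -
  \<comment> \<open>squared increments, with a weight that turns boundedness into geometric decay\<close>
  define d where "d = (\<lambda>k x. 2 ^ k * (norm (u (Suc k) x - u k x))\<^sup>2)"
  have dnn: "0 \<le> d k x" for k x by (simp add: d_def)
  have [measurable]: "d k \<in> borel_measurable borel" for k unfolding d_def by measurable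
  have "(\<integral>\<^sup>+x. (\<Sum>k. ennreal (d k x)) \<partial>lborel) = (\<Sum>k. \<integral>\<^sup>+x. ennreal (d k x) \<partial>lborel)"
    by (rule nn_integral_suminf) simp
  also have "\<dots> \<le> (\<Sum>k. C * ennreal ((1/4) ^ k))"
  proof (rule suminf_le)
    fix k
    have "(\<integral>\<^sup>+x. ennreal (d k x) \<partial>lborel) = ennreal (2 ^ k) * energy (\<lambda>x. u (Suc k) x - u k x)"
      unfolding d_def energy_def by (subst nn_integral_cmult[symmetric]) (auto simp: ennreal_mult)
    also have "\<dots> \<le> ennreal (2 ^ k) * (C * ennreal ((1/8) ^ k))"
      by (intro mult_left_mono C) auto
    also have "\<dots> = C * ennreal ((1/4) ^ k)"
      by (subst mult.left_commute, subst ennreal_mult[symmetric])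
        (auto simp flip: power_mult_distrib)
    finally show "(\<integral>\<^sup>+x. ennreal (d k x) \<partial>lborel) \<le> C * ennreal ((1/4) ^ k)" .
  qed auto
  also have "\<dots> = C * (\<Sum>k. ennreal ((1/4) ^ k))" by simp
  also have "\<dots> < \<infinity>"
    using C(1) by (simp add: ennreal_mult_less_top suminf_ennreal2 summable_geometric)
  finally have "AE x in lborel. (\<Sum>k. ennreal (d k x)) \<noteq> \<infinity>"
    by (intro nn_integral_PInf_AE) auto
  then have conv: "AE x in lborel. convergent (\<lambda>k. u k x)"
  proof (eventually_elim)
    case (elim x)
    then have "summable (\<lambda>k. d k x)"
      by (intro summable_suminf_not_top dnn) (auto simp: top_ennreal_def)
    then have "\<exists>K. \<forall>k. norm (d k x) \<le> K"
      using summable_imp_Bseq[of "\<lambda>k. d k x"] by (auto simp: Bseq_def)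
    then obtain K where K: "\<And>k. d k x \<le> K" by (auto simp: dnn)
    have "norm (u (Suc k) x - u k x) \<le> sqrt K * (1 / sqrt 2) ^ k" for k
    proof -
      have "(norm (u (Suc k) x - u k x))\<^sup>2 \<le> K * (1/2) ^ k"
        using K[of k] by (simp add: d_def field_simps)
      then have "norm (u (Suc k) x - u k x) \<le> sqrt (K * (1/2) ^ k)"
        by (rule real_le_rsqrt)
      then show ?thesis by (simp add: real_sqrt_mult real_sqrt_power real_sqrt_divide)
    qed
    then have "summable (\<lambda>k. u (Suc k) x - u k x)"
      by (rule summable_comparison_test'[rotated, where N = 0])
        (intro summable_mult summable_geometric, simp)
    then have "convergent (\<lambda>n. u n x - u 0 x)"
      by (simp only: summable_iff_convergent sum_lessThan_telescope[of "\<lambda>n. u n x"])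
    then have "convergent (\<lambda>n. (u n x - u 0 x) + u 0 x)"
      by (intro convergent_add convergent_const)
    then show ?case by simp
  qed
  define g where "g = (\<lambda>x. lim (\<lambda>k. u k x))"
  have [measurable]: "g \<in> borel_measurable borel" unfolding g_def by measurable
  have bound: "energy (\<lambda>x. u k x - g x) \<le> C * ennreal ((1/8) ^ k)" for k
  proof -
    have "energy (\<lambda>x. u k x - g x) = (\<integral>\<^sup>+x. liminf (\<lambda>j. ennreal ((norm (u j x - u k x))\<^sup>2)) \<partial>lborel)"
      unfolding energy_def
    proof (rule nn_integral_cong_AE, use conv in eventually_elim)
      case (elim x)
      then have "(\<lambda>j. u j x) \<longlonglongrightarrow> g x" by (simp add: g_def convergent_LIMSEQ_iff)
      then have "(\<lambda>j. ennreal ((norm (u j x - u k x))\<^sup>2)) \<longlonglongrightarrow> ennreal ((norm (g x - u k x))\<^sup>2)"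
        by (intro tendsto_intros tendsto_ennrealI)
      from lim_imp_Liminf[OF _ this] show ?case by (simp add: norm_minus_commute)
    qed
    also have "\<dots> \<le> liminf (\<lambda>j. energy (\<lambda>x. u j x - u k x))"
      unfolding energy_def by (rule nn_integral_liminf) auto
    also have "\<dots> \<le> C * ennreal ((1/8) ^ k)"
    proof (rule order_trans[OF Liminf_le_Limsup Limsup_bounded])
      show "eventually (\<lambda>j. energy (\<lambda>x. u j x - u k x) \<le> C * ennreal ((1/8) ^ k)) sequentially"
        using eventually_ge_at_top[of k] by eventually_elim (rule C(2))
    qed simp
    finally show ?thesis .
  qed
  have "(\<lambda>k. C * ennreal ((1/8) ^ k)) \<longlonglongrightarrow> C * ennreal 0"
    using C(1) by (intro ennreal_tendsto_cmult tendsto_ennrealI LIMSEQ_power_zero) auto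
  then have lim0: "(\<lambda>k. C * ennreal ((1/8) ^ k)) \<longlonglongrightarrow> 0"
    by simp
  have "(\<lambda>k. energy (\<lambda>x. u k x - g x)) \<longlonglongrightarrow> 0"
    by (rule tendsto_sandwich[OF _ _ tendsto_const lim0]) (simp_all add: bound)
  then show ?thesis by (intro bexI[of _ g]) auto
qed


section \<open>Continuity of translations\<close>

lemma ennreal_tendsto_0I:
  fixes X :: "nat \<Rightarrow> ennreal"
  assumes "\<And>e::real. e > 0 \<Longrightarrow> eventually (\<lambda>k. X k \<le> ennreal e) sequentially"
  shows "X \<longlonglongrightarrow> 0"
proof (rule order_tendstoI)
  fix a :: ennreal assume "0 < a"
  then obtain b where b: "0 < b" "b < a" using dense by blast
  then obtain e where e: "b = ennreal e" "e > 0"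
    by (cases b) (auto simp: ennreal_less_zero_iff less_top[symmetric])
  from assms[OF e(2)] show "eventually (\<lambda>k. X k < a) sequentially"
    by eventually_elim (use b e in auto)
qed auto

lemma energy_dominated_convergence:
  fixes u :: "nat \<Rightarrow> 'a::euclidean_space \<Rightarrow> 'v::euclidean_space"
  assumes [measurable]: "\<And>k. u k \<in> borel_measurable borel" "v \<in> borel_measurable borel"
      "w \<in> borel_measurable borel"
    and bound: "\<And>k. AE x in lborel. ennreal ((norm (u k x - v x))\<^sup>2) \<le> w x"
    and w: "(\<integral>\<^sup>+x. w x \<partial>lborel) < \<infinity>"
    and lim: "AE x in lborel. (\<lambda>k. u k x) \<longlonglongrightarrow> v x"
  shows "(\<lambda>k. energy (\<lambda>x. u k x - v x)) \<longlonglongrightarrow> 0"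
proof -
  have "(\<lambda>k. energy (\<lambda>x. u k x - v x)) \<longlonglongrightarrow> nn_integral lborel (\<lambda>x::'a. 0)"
    unfolding energy_def
  proof (rule nn_integral_dominated_convergence[where w = w])
    show "AE x in lborel. (\<lambda>k. ennreal ((norm (u k x - v x))\<^sup>2)) \<longlonglongrightarrow> 0"
      using lim
    proof eventually_elim
      case (elim x)
      then have "(\<lambda>k. ennreal ((norm (u k x - v x))\<^sup>2)) \<longlonglongrightarrow> ennreal ((norm (v x - v x))\<^sup>2)"
        by (intro tendsto_ennrealI tendsto_intros)
      then show ?case by simp
    qed
  qed (use bound w in auto)
  then show ?thesis by simp
qed

lemma energy_truncate_tendsto:
  fixes f :: "'a::euclidean_space \<Rightarrow> 'v::euclidean_space"
  assumes [measurable]: "f \<in> borel_measurable borel" "\<And>k::nat. A k \<in> sets borel"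
    and f: "energy f < \<infinity>" and A: "\<And>x. eventually (\<lambda>k. x \<in> A k) sequentially"
  shows "(\<lambda>k. energy (\<lambda>x. indicator (A k) x *\<^sub>R f x - f x)) \<longlonglongrightarrow> 0"
proof (rule energy_dominated_convergence[where w = "\<lambda>x. ennreal ((norm (f x))\<^sup>2)"])
  show "AE x in lborel. (\<lambda>k. indicator (A k) x *\<^sub>R f x) \<longlonglongrightarrow> f x"
  proof (rule AE_I2, rule tendsto_eventually)
    fix x show "eventually (\<lambda>k. indicator (A k) x *\<^sub>R f x = f x) sequentially"
      using A[of x] by eventually_elim simp
  qed
  show "AE x in lborel. ennreal ((norm (indicator (A k) x *\<^sub>R f x - f x))\<^sup>2) \<le> ennreal ((norm (f x))\<^sup>2)" for k
    by (auto simp: indicator_def)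
qed (use f in \<open>auto simp: energy_def\<close>)

lemma cball_majorant:
  shows "(\<lambda>x. ennreal (M * indicator (cball (0::'a::euclidean_space) R) x)) \<in> borel_measurable borel"
    and "(\<integral>\<^sup>+x. ennreal (M * indicator (cball (0::'a) R) x) \<partial>lborel) < \<infinity>"
proof -
  have [measurable]: "cball (0::'a) R \<in> sets borel" by simp
  show "(\<lambda>x. ennreal (M * indicator (cball (0::'a) R) x)) \<in> borel_measurable borel" by measurable
  have "(\<integral>\<^sup>+x. ennreal (M * indicator (cball (0::'a) R) x) \<partial>lborel) =
     (\<integral>\<^sup>+x. ennreal M * indicator (cball (0::'a) R) x \<partial>lborel)"
    by (intro nn_integral_cong) (auto simp: indicator_def)
  also have "\<dots> = ennreal M * emeasure lborel (cball (0::'a) R)"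
    by (rule nn_integral_cmult_indicator) auto
  also have "\<dots> < \<infinity>"
    using emeasure_lborel_cball_finite[of "0::'a" R] by (auto simp: ennreal_mult_less_top)
  finally show "(\<integral>\<^sup>+x. ennreal (M * indicator (cball (0::'a) R) x) \<partial>lborel) < \<infinity>" .
qed

text \<open>
  A measurable function is almost everywhere a limit of continuous ones. To dominate these, their
  values are pulled back radially into the ball of radius \<open>R\<close> and they are cut off outside the ball
  of radius \<open>R + 1\<close>; neither operation changes the limit.
\<close>

lemma bounded_function_approx_continuous:
  fixes f :: "'a::euclidean_space \<Rightarrow> 'v::euclidean_space"
  assumes [measurable]: "f \<in> borel_measurable borel" and R: "\<And>x. norm (f x) \<le> R"
    and supp: "\<And>x. norm x > R \<Longrightarrow> f x = 0" and "R > 0"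
  shows "\<exists>g. (\<forall>n. continuous_on UNIV (g n) \<and> (\<forall>x. norm x > R + 1 \<longrightarrow> g n x = 0)) \<and>
     (\<lambda>n::nat. energy (\<lambda>x. g n x - f x)) \<longlonglongrightarrow> 0"
proof -
  have "f measurable_on UNIV"
    by (subst measurable_on_iff_borel_measurable) (simp_all add: lebesgue_on_UNIV_eq measurable_completion)
  then obtain N g where N: "negligible N" and g: "\<And>n. continuous_on UNIV (g n)"
    and lim: "\<And>x. x \<notin> N \<Longrightarrow> (\<lambda>n. g n x) \<longlonglongrightarrow> f x"
    unfolding measurable_on_def by auto
  define \<phi> where "\<phi> = (\<lambda>x::'a. max 0 (min 1 (R + 1 - norm x)))"
  define c where "c = (\<lambda>v::'v. (R / max R (norm v)) *\<^sub>R v)"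
  define h where "h = (\<lambda>n x. \<phi> x *\<^sub>R c (g n x))"
  have c_cont: "continuous_on UNIV c"
    unfolding c_def using \<open>R > 0\<close> by (intro continuous_intros) auto
  have \<phi>_cont: "continuous_on UNIV \<phi>"
    unfolding \<phi>_def by (intro continuous_intros)
  have h_cont: "continuous_on UNIV (h n)" for n
    unfolding h_def using continuous_on_compose2[OF c_cont g[of n]]
    by (intro continuous_intros \<phi>_cont) auto
  have c_le: "norm (c v) \<le> R" for v
    using \<open>R > 0\<close> by (auto simp: c_def field_simps max_def)
  have c_id: "c (f x) = f x" for x
    using \<open>R > 0\<close> R[of x] by (simp add: c_def max_def)
  have \<phi>_id: "\<phi> x *\<^sub>R f x = f x" for x
    using supp[of x] by (cases "norm x \<le> R") (auto simp: \<phi>_def)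
  have h_supp: "h n x = 0" if "norm x > R + 1" for n x
    using that by (simp add: h_def \<phi>_def)
  have h_le: "norm (h n x) \<le> R" for n x
  proof -
    have "norm (h n x) \<le> 1 * R"
      unfolding h_def norm_scaleR by (intro mult_mono c_le) (auto simp: \<phi>_def)
    then show ?thesis by simp
  qed
  have [measurable]: "h n \<in> borel_measurable borel" for n
    by (intro borel_measurable_continuous_onI h_cont)
  define w where "w = (\<lambda>x::'a. ennreal ((2 * R)\<^sup>2 * indicator (cball (0::'a) (R + 1)) x))"
  have w: "w \<in> borel_measurable borel" "(\<integral>\<^sup>+x. w x \<partial>lborel) < \<infinity>"
    unfolding w_def by (rule cball_majorant)+
  have "(\<lambda>n. energy (\<lambda>x. h n x - f x)) \<longlonglongrightarrow> 0"
  proof (rule energy_dominated_convergence[where w = w])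
    show "AE x in lborel. ennreal ((norm (h k x - f x))\<^sup>2) \<le> w x" for k
      unfolding w_def
    proof (intro AE_I2 ennreal_leI)
      fix x
      show "(norm (h k x - f x))\<^sup>2 \<le> (2 * R)\<^sup>2 * indicator (cball 0 (R + 1)) x"
      proof (cases "norm x \<le> R + 1")
        case True
        have "norm (h k x - f x) \<le> 2 * R"
          using norm_triangle_ineq4[of "h k x" "f x"] h_le[of k x] R[of x] by simp
        then have "(norm (h k x - f x))\<^sup>2 \<le> (2 * R)\<^sup>2" by (intro power_mono) auto
        with True show ?thesis by simp
      next
        case False
        then show ?thesis using h_supp[of x k] supp[of x] by simp
      qed
    qed
    have "N \<in> null_sets lebesgue" using N by (simp add: negligible_iff_null_sets)
    then have "AE x in lebesgue. x \<notin> N" by (rule AE_not_in)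
    then have "AE x in lborel. x \<notin> N" by (simp add: AE_completion_iff)
    then show "AE x in lborel. (\<lambda>n. h n x) \<longlonglongrightarrow> f x"
    proof eventually_elim
      case (elim x)
      have "isCont c (f x)" using c_cont by (simp add: continuous_on_eq_continuous_at)
      then have "(\<lambda>n. c (g n x)) \<longlonglongrightarrow> c (f x)" using lim[OF elim] by (rule isCont_tendsto_compose)
      then have "(\<lambda>n. h n x) \<longlonglongrightarrow> \<phi> x *\<^sub>R c (f x)"
        unfolding h_def by (intro tendsto_intros)
      then show ?case by (simp add: c_id \<phi>_id)
    qed
  qed (use w in auto)
  with h_cont h_supp show ?thesis by blast
qed

lemma square_integrable_approx_continuous:
  fixes f :: "'a::euclidean_space \<Rightarrow> 'v::euclidean_space"
  assumes [measurable]: "f \<in> borel_measurable borel" and f: "energy f < \<infinity>" and "e > (0::real)"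
  shows "\<exists>g R. continuous_on UNIV g \<and> (\<forall>x. norm x > R \<longrightarrow> g x = 0) \<and> energy (\<lambda>x. g x - f x) \<le> ennreal e"
proof -
  define A where "A = (\<lambda>k::nat. {x. norm x \<le> real (Suc k) \<and> norm (f x) \<le> real (Suc k)})"
  define f' where "f' = (\<lambda>k x. indicator (A k) x *\<^sub>R f x)"
  have A[measurable]: "A k \<in> sets borel" for k
    unfolding A_def by measurable
  have [measurable]: "f' k \<in> borel_measurable borel" for k
    unfolding f'_def by measurable
  have "(\<lambda>k. energy (\<lambda>x. f' k x - f x)) \<longlonglongrightarrow> 0"
    unfolding f'_def
  proof (rule energy_truncate_tendsto)
    fix x
    obtain n where n: "max (norm x) (norm (f x)) \<le> real n" using real_arch_simple by blast
    show "eventually (\<lambda>k. x \<in> A k) sequentially"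
      using eventually_ge_at_top[of n] by eventually_elim (use n in \<open>auto simp: A_def\<close>)
  qed (use f in auto)
  then have "eventually (\<lambda>k. energy (\<lambda>x. f' k x - f x) < ennreal (e / 4)) sequentially"
    by (rule order_tendstoD) (use \<open>e > 0\<close> in auto)
  then obtain k where k: "energy (\<lambda>x. f' k x - f x) < ennreal (e / 4)"
    by (auto simp: eventually_sequentially)
  have f'_le: "norm (f' k x) \<le> real (Suc k)" for x
    by (simp add: f'_def A_def indicator_def)
  have f'_supp: "f' k x = 0" if "norm x > real (Suc k)" for x
    using that by (simp add: f'_def A_def)
  \<comment> \<open>one bound serves for both the values and the support of the truncation\<close>
  obtain g where g: "\<And>n. continuous_on UNIV (g n)" "\<And>n x. norm x > real (Suc k) + 1 \<Longrightarrow> g n x = 0"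
    and lim: "(\<lambda>n::nat. energy (\<lambda>x. g n x - f' k x)) \<longlonglongrightarrow> 0"
    using bounded_function_approx_continuous[of "f' k" "real (Suc k)", OF _ f'_le f'_supp] by auto
  from lim have "eventually (\<lambda>n. energy (\<lambda>x. g n x - f' k x) < ennreal (e / 4)) sequentially"
    by (rule order_tendstoD) (use \<open>e > 0\<close> in auto)
  then obtain n where n: "energy (\<lambda>x. g n x - f' k x) < ennreal (e / 4)"
    by (auto simp: eventually_sequentially)
  have [measurable]: "g n \<in> borel_measurable borel"
    by (intro borel_measurable_continuous_onI g)
  have "energy (\<lambda>x. g n x - f x) \<le> 2 * energy (\<lambda>x. g n x - f' k x) + 2 * energy (\<lambda>x. f' k x - f x)"
    by (rule energy_triangle2) auto
  also have "\<dots> \<le> 2 * ennreal (e / 4) + 2 * ennreal (e / 4)"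
    using n k by (intro add_mono mult_left_mono) auto
  also have "\<dots> = ennreal (2 * (e / 4) + 2 * (e / 4))"
    using \<open>e > 0\<close> by (simp add: numeral_mult_ennreal ennreal_plus[symmetric] del: ennreal_plus)
  finally show ?thesis
    using g(1)[of n] g(2)[of _ n] by (intro exI[of _ "g n"] exI[of _ "real (Suc k) + 1"]) auto
qed

lemma translation_continuous_of_continuous:
  fixes g :: "'a::euclidean_space \<Rightarrow> 'v::euclidean_space"
  assumes g: "continuous_on UNIV g" "\<And>x. norm x > R \<Longrightarrow> g x = 0" and s: "s \<longlonglongrightarrow> 0"
  shows "(\<lambda>k. energy (\<lambda>x. g (x + s k) - g x)) \<longlonglongrightarrow> 0"
proof -
  have [measurable]: "g \<in> borel_measurable borel"
    by (intro borel_measurable_continuous_onI g)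
  obtain B where B: "\<And>k. norm (s k) \<le> B"
    using convergent_imp_Bseq[OF convergentI[OF s]] by (auto simp: Bseq_def)
  have "compact (g ` cball 0 R)"
    by (intro compact_continuous_image continuous_on_subset[OF g(1)]) auto
  then obtain M where M: "\<And>x. norm x \<le> R \<Longrightarrow> norm (g x) \<le> M"
    using compact_imp_bounded[of "g ` cball 0 R"] by (force simp: bounded_iff)
  have gM: "norm (g x) \<le> \<bar>M\<bar>" for x
    using M[of x] g(2)[of x] by (cases "norm x \<le> R") auto
  define w where "w = (\<lambda>x::'a. ennreal ((2 * \<bar>M\<bar>)\<^sup>2 * indicator (cball (0::'a) (R + B)) x))"
  have w: "w \<in> borel_measurable borel" "(\<integral>\<^sup>+x. w x \<partial>lborel) < \<infinity>"
    unfolding w_def by (rule cball_majorant)+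
  show ?thesis
  proof (rule energy_dominated_convergence[where w = w])
    show "AE x in lborel. ennreal ((norm (g (x + s k) - g x))\<^sup>2)
        \<le> w x" for k
      unfolding w_def
    proof (intro AE_I2 ennreal_leI)
      fix x
      show "(norm (g (x + s k) - g x))\<^sup>2 \<le> (2 * \<bar>M\<bar>)\<^sup>2 * indicator (cball 0 (R + B)) x"
      proof (cases "norm x \<le> R + B")
        case True
        have "norm (g (x + s k) - g x) \<le> 2 * \<bar>M\<bar>"
          using norm_triangle_ineq4[of "g (x + s k)" "g x"] gM[of x] gM[of "x + s k"] by simp
        then have "(norm (g (x + s k) - g x))\<^sup>2 \<le> (2 * \<bar>M\<bar>)\<^sup>2" by (intro power_mono) auto
        with True show ?thesis by simp
      next
        case False
        have "norm x \<le> norm (x + s k) + norm (s k)"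
          using norm_triangle_ineq4[of "x + s k" "s k"] by simp
        with False B[of k] norm_ge_zero[of "s k"] have "norm (x + s k) > R" "norm x > R" by linarith+
        with False show ?thesis by (simp add: g(2))
      qed
    qed
    show "AE x in lborel. (\<lambda>k. g (x + s k)) \<longlonglongrightarrow> g x"
    proof (rule AE_I2)
      fix x
      have "isCont g x" using g(1) by (simp add: continuous_on_eq_continuous_at)
      moreover have "(\<lambda>k. x + s k) \<longlonglongrightarrow> x" using tendsto_add[OF tendsto_const[of x] s] by simp
      ultimately show "(\<lambda>k. g (x + s k)) \<longlonglongrightarrow> g x" by (rule isCont_tendsto_compose)
    qed
  qed (use w in auto)
qed

text \<open>
  For continuous functions of compact support this is dominated convergence; in general such a
  function is \<open>L\<^sup>2\<close>-close to \<open>f\<close>, and translations preserve the distance.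
\<close>

lemma translation_continuous:
  fixes f :: "'a::euclidean_space \<Rightarrow> 'v::euclidean_space"
  assumes [measurable]: "f \<in> borel_measurable borel" and f: "energy f < \<infinity>" and s: "s \<longlonglongrightarrow> 0"
  shows "(\<lambda>k. energy (\<lambda>x. f (x + s k) - f x)) \<longlonglongrightarrow> 0"
proof (rule ennreal_tendsto_0I)
  fix e :: real assume "e > 0"
  then obtain g R where g: "continuous_on UNIV g" "\<And>x. norm x > R \<Longrightarrow> g x = 0"
    and fg: "energy (\<lambda>x. g x - f x) \<le> ennreal (e / 10)"
    using square_integrable_approx_continuous[OF assms(1) f, of "e / 10"] by auto
  have [measurable]: "g \<in> borel_measurable borel"
    by (intro borel_measurable_continuous_onI g)
  have "eventually (\<lambda>k. energy (\<lambda>x. g (x + s k) - g x) < ennreal (e / 10)) sequentially"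
    using translation_continuous_of_continuous[OF g s] by (rule order_tendstoD) (use \<open>e > 0\<close> in auto)
  then show "eventually (\<lambda>k. energy (\<lambda>x. f (x + s k) - f x) \<le> ennreal e) sequentially"
  proof eventually_elim
    case (elim k)
    have 1: "energy (\<lambda>x. f (x + s k) - g (x + s k)) = energy (\<lambda>x. f x - g x)"
      by (rule energy_translate[of "\<lambda>x. f x - g x"]) auto
    have "energy (\<lambda>x. f (x + s k) - f x) \<le>
        2 * energy (\<lambda>x. f (x + s k) - g (x + s k)) + 2 * energy (\<lambda>x. g (x + s k) - f x)"
      by (rule energy_triangle2) auto
    also have "\<dots> \<le> 2 * ennreal (e / 10) + 2 * ennreal (2 * e / 5)"
    proof (intro add_mono mult_left_mono)
      show "energy (\<lambda>x. f (x + s k) - g (x + s k)) \<le> ennreal (e / 10)"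
        using fg by (simp add: 1 energy_minus_commute[of f])
      have "energy (\<lambda>x. g (x + s k) - f x) \<le>
          2 * energy (\<lambda>x. g (x + s k) - g x) + 2 * energy (\<lambda>x. g x - f x)"
        by (rule energy_triangle2) auto
      also have "\<dots> \<le> 2 * ennreal (e / 10) + 2 * ennreal (e / 10)"
        using elim fg by (intro add_mono mult_left_mono) auto
      also have "\<dots> = ennreal (2 * e / 5)"
        using \<open>e > 0\<close> by (simp add: numeral_mult_ennreal ennreal_plus[symmetric] del: ennreal_plus)
      finally show "energy (\<lambda>x. g (x + s k) - f x) \<le> ennreal (2 * e / 5)" .
    qed auto
    also have "\<dots> = ennreal e"
      using \<open>e > 0\<close> by (simp add: numeral_mult_ennreal ennreal_plus[symmetric] del: ennreal_plus)
    finally show ?case .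
  qed
qed


section \<open>The Gaussian and its Fourier transform\<close>

lemma lborel_integral_affine:
  fixes f :: "'a::euclidean_space \<Rightarrow> 'b::{banach, second_countable_topology}"
  assumes [measurable]: "f \<in> borel_measurable borel" and c: "c > 0"
  shows "(\<integral>x. f x \<partial>lborel) = c ^ DIM('a) *\<^sub>R (\<integral>x. f (t + c *\<^sub>R x) \<partial>lborel)"
proof -
  have "(\<integral>x. f x \<partial>lborel) =
      (\<integral>x. f x \<partial>density (distr lborel borel (\<lambda>x. t + c *\<^sub>R x)) (\<lambda>_. ennreal (\<bar>c\<bar> ^ DIM('a))))"
    by (subst lborel_affine[of c t]) (use c in auto)
  also have "\<dots> = c ^ DIM('a) *\<^sub>R (\<integral>x. f (t + c *\<^sub>R x) \<partial>lborel)"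
    using c by (simp add: integral_density integral_distr)
  finally show ?thesis .
qed

lemma
  fixes \<phi> :: "'a::euclidean_space \<Rightarrow> real \<Rightarrow> 'b::{real_normed_field, banach, second_countable_topology}"
  assumes \<phi>: "\<And>b. b \<in> Basis \<Longrightarrow> integrable lborel (\<phi> b)"
  shows integrable_prod_coordinates: "integrable lborel (\<lambda>x::'a. \<Prod>b\<in>Basis. \<phi> b (x \<bullet> b))" (is ?int)
    and integral_prod_coordinates:
      "(\<integral>x. (\<Prod>b\<in>Basis. \<phi> b (x \<bullet> b)) \<partial>lborel) = (\<Prod>b\<in>Basis. integral\<^sup>L lborel (\<phi> b))" (is ?eq)
proof -
  interpret product_sigma_finite "\<lambda>b::'a. lborel :: real measure" by standard
  have [measurable]: "\<phi> b \<in> borel_measurable borel" if "b \<in> Basis" for b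
    using borel_measurable_integrable[OF \<phi>[OF that]] by simp
  have m: "(\<lambda>x::'a. \<Prod>b\<in>Basis. \<phi> b (x \<bullet> b)) \<in> borel_measurable borel" by measurable
  have *: "(\<Prod>b\<in>Basis. \<phi> b ((\<Sum>c\<in>Basis. f c *\<^sub>R c) \<bullet> b)) = (\<Prod>b\<in>Basis. \<phi> b (f b))" for f :: "'a \<Rightarrow> real"
    by (intro prod.cong refl) simp
  have "integrable (\<Pi>\<^sub>M b\<in>Basis. lborel) (\<lambda>f. \<Prod>b\<in>Basis. \<phi> b (f b))"
    using \<phi> by (intro product_integrable_prod) auto
  then show ?int
    by (subst lborel_eq, subst integrable_distr_eq) (use m in \<open>auto simp: *\<close>)
  have "(\<integral>x. (\<Prod>b\<in>Basis. \<phi> b (x \<bullet> b)) \<partial>lborel) =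
      (\<integral>f. (\<Prod>b\<in>Basis. \<phi> b (f b)) \<partial>(\<Pi>\<^sub>M b\<in>Basis. lborel))"
    by (subst lborel_eq, subst integral_distr) (use m in \<open>auto simp: *\<close>)
  also have "\<dots> = (\<Prod>b\<in>Basis. integral\<^sup>L lborel (\<phi> b))"
    using \<phi> by (intro product_integral_prod) auto
  finally show ?eq .
qed

definition gauss :: "'a::euclidean_space \<Rightarrow> real" where
  "gauss x = (\<Prod>b\<in>Basis. std_normal_density (x \<bullet> b))"

lemma gauss_eq: "gauss x = (1 / sqrt (2 * pi)) ^ DIM('a) * exp (- (norm x)\<^sup>2 / 2)"
  for x :: "'a::euclidean_space"
proof -
  have "(\<Prod>b\<in>Basis. exp (- (x \<bullet> b)\<^sup>2 / 2)) = exp (\<Sum>b\<in>Basis. - (x \<bullet> b)\<^sup>2 / 2)"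
    by (simp add: exp_sum)
  also have "(\<Sum>b\<in>Basis. - (x \<bullet> b)\<^sup>2 / 2) = - (norm x)\<^sup>2 / 2"
    unfolding power2_norm_eq_inner euclidean_inner[of x x]
    by (simp add: sum_negf power2_eq_square flip: sum_divide_distrib)
  finally show ?thesis
    unfolding gauss_def std_normal_density_def prod.distrib by simp
qed

lemma gauss_pos: "gauss x > 0"
  by (simp add: gauss_eq)

lemma gauss_measurable [measurable]: "gauss \<in> borel_measurable borel"
  unfolding gauss_def[abs_def] by measurable

lemma gauss_minus: "gauss (- x) = gauss x"
  by (simp add: gauss_eq)

lemma gauss_integrable [simp]: "integrable lborel gauss"
  unfolding gauss_def[abs_def] by (rule integrable_prod_coordinates) simp

lemma gauss_integral: "(\<integral>x. gauss x \<partial>lborel) = 1"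
  unfolding gauss_def by (subst integral_prod_coordinates) auto

text \<open>
  The integral of \<open>gauss x * exp (\<i> (x \<bullet> z))\<close> factors over the coordinates into values of the
  characteristic function of the standard normal distribution; take real and imaginary parts.
\<close>

lemma gauss_fourier:
  shows "(\<integral>x. gauss x * cos (x \<bullet> z) \<partial>lborel) = exp (- (norm z)\<^sup>2 / 2)"
    and "(\<integral>x. gauss x * sin (x \<bullet> z) \<partial>lborel) = 0"
proof -
  have 1: "(\<integral>x. std_normal_density x *\<^sub>R iexp (t * x) \<partial>lborel) = complex_of_real (exp (- t\<^sup>2 / 2))" for t
    using char_std_normal_distribution[THEN fun_cong, of t]
    by (simp add: char_def integral_density)
  have int: "integrable lborel (\<lambda>x. std_normal_density x *\<^sub>R iexp (t * x))" for t
    by (rule Bochner_Integration.integrable_bound[of _ "std_normal_density"]) auto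
  have prod: "(\<Prod>b\<in>Basis. std_normal_density (x \<bullet> b) *\<^sub>R iexp ((z \<bullet> b) * (x \<bullet> b))) =
      gauss x *\<^sub>R iexp (x \<bullet> z)" for x
    unfolding gauss_def scaleR_conv_of_real prod.distrib of_real_prod exp_sum[OF finite_Basis, symmetric]
    by (simp add: euclidean_inner[of x z] sum_distrib_left mult_ac)
  have int': "integrable lborel (\<lambda>x. gauss x *\<^sub>R iexp (x \<bullet> z))"
    using integrable_prod_coordinates[of "\<lambda>b y. std_normal_density y *\<^sub>R iexp ((z \<bullet> b) * y)", OF int]
    by (simp only: prod)
  have "(\<integral>x. gauss x *\<^sub>R iexp (x \<bullet> z) \<partial>lborel) =
      (\<Prod>b\<in>Basis. complex_of_real (exp (- (z \<bullet> b)\<^sup>2 / 2)))"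
    using integral_prod_coordinates[of "\<lambda>b y. std_normal_density y *\<^sub>R iexp ((z \<bullet> b) * y)", OF int]
    by (simp only: prod 1)
  also have "\<dots> = complex_of_real (exp (\<Sum>b\<in>Basis. - (z \<bullet> b)\<^sup>2 / 2))"
    by (simp add: exp_sum)
  also have "(\<Sum>b\<in>Basis. - (z \<bullet> b)\<^sup>2 / 2) = - (norm z)\<^sup>2 / 2"
    unfolding power2_norm_eq_inner euclidean_inner[of z z]
    by (simp add: sum_negf power2_eq_square flip: sum_divide_distrib)
  finally have eq: "(\<integral>x. gauss x *\<^sub>R iexp (x \<bullet> z) \<partial>lborel) = complex_of_real (exp (- (norm z)\<^sup>2 / 2))" .
  from integral_Re[OF int'] show "(\<integral>x. gauss x * cos (x \<bullet> z) \<partial>lborel) = exp (- (norm z)\<^sup>2 / 2)"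
    unfolding eq by (simp add: Re_exp)
  from integral_Im[OF int'] show "(\<integral>x. gauss x * sin (x \<bullet> z) \<partial>lborel) = 0"
    unfolding eq by (simp add: Im_exp)
qed

lemma scaled_gauss_integrable:
  assumes "\<delta> > 0"
  shows "integrable lborel (\<lambda>w::'a::euclidean_space. gauss (\<delta> *\<^sub>R w))"
proof -
  have "(\<integral>\<^sup>+x. ennreal (gauss (x::'a)) \<partial>lborel) = (\<integral>\<^sup>+x. ennreal (gauss x) \<partial>density (distr lborel borel (\<lambda>x::'a. 0 + \<delta> *\<^sub>R x)) (\<lambda>_. ennreal (\<bar>\<delta>\<bar> ^ DIM('a))))"
    by (subst lborel_affine[of \<delta> 0]) (use assms in auto)
  also have "\<dots> = ennreal (\<delta> ^ DIM('a)) * (\<integral>\<^sup>+x. ennreal (gauss (\<delta> *\<^sub>R (x::'a))) \<partial>lborel)"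
    using assms by (simp add: nn_integral_density nn_integral_distr nn_integral_cmult)
  finally have "ennreal (\<delta> ^ DIM('a)) * (\<integral>\<^sup>+x. ennreal (gauss (\<delta> *\<^sub>R (x::'a))) \<partial>lborel) < \<infinity>"
    using gauss_integrable[where ?'a = 'a] by (simp add: integrable_iff_bounded abs_of_pos[OF gauss_pos] del: gauss_integrable)
  moreover have "\<not> \<delta> ^ DIM('a) \<le> 0" using assms by (simp add: not_le)
  ultimately show ?thesis
    by (auto simp: integrable_iff_bounded abs_of_pos[OF gauss_pos] ennreal_mult_less_top ennreal_eq_0_iff)
qed

lemma scaled_gauss_fourier:
  fixes z :: "'a::euclidean_space"
  assumes "\<delta> > 0"
  shows "\<delta> ^ DIM('a) * (\<integral>w. gauss (\<delta> *\<^sub>R w) * cos (w \<bullet> z) \<partial>lborel) =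
      sqrt (2 * pi) ^ DIM('a) * gauss (z /\<^sub>R \<delta>)"
    and "(\<integral>w. gauss (\<delta> *\<^sub>R w) * sin (w \<bullet> z) \<partial>lborel) = 0"
proof -
  have *: "inverse \<delta> * (\<delta> * r) = r" for r using assms by simp
  have "exp (- (norm (z /\<^sub>R \<delta>))\<^sup>2 / 2) = \<delta> ^ DIM('a) * (\<integral>w. gauss (\<delta> *\<^sub>R w) * cos (w \<bullet> z) \<partial>lborel)"
    unfolding gauss_fourier(1)[symmetric]
    by (subst lborel_integral_affine[OF _ assms, of _ 0]) (simp_all add: *)
  moreover have "exp (- (norm (z /\<^sub>R \<delta>))\<^sup>2 / 2) = sqrt (2 * pi) ^ DIM('a) * gauss (z /\<^sub>R \<delta>)"
    unfolding gauss_eq by (simp add: power_one_over)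
  ultimately show "\<delta> ^ DIM('a) * (\<integral>w. gauss (\<delta> *\<^sub>R w) * cos (w \<bullet> z) \<partial>lborel) =
      sqrt (2 * pi) ^ DIM('a) * gauss (z /\<^sub>R \<delta>)" by simp
  have "0 = \<delta> ^ DIM('a) * (\<integral>w. gauss (\<delta> *\<^sub>R w) * sin (w \<bullet> z) \<partial>lborel)"
    unfolding gauss_fourier(2)[of "z /\<^sub>R \<delta>", symmetric]
    by (subst lborel_integral_affine[OF _ assms, of _ 0]) (simp_all add: *)
  with assms show "(\<integral>w. gauss (\<delta> *\<^sub>R w) * sin (w \<bullet> z) \<partial>lborel) = 0" by simp
qed


section \<open>The Fourier transform for a complex structure\<close>

lemma energy_eq_integral:
  fixes f :: "'a::euclidean_space \<Rightarrow> 'v::euclidean_space"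
  assumes [measurable]: "f \<in> borel_measurable borel" and "energy f < \<infinity>"
  shows "integrable lborel (\<lambda>x. (norm (f x))\<^sup>2)"
    and "energy f = ennreal (\<integral>x. (norm (f x))\<^sup>2 \<partial>lborel)"
proof -
  show "integrable lborel (\<lambda>x. (norm (f x))\<^sup>2)"
    using assms(2) by (intro integrableI_bounded) (auto simp: energy_def)
  then show "energy f = ennreal (\<integral>x. (norm (f x))\<^sup>2 \<partial>lborel)"
    unfolding energy_def by (intro nn_integral_eq_integral) auto
qed

lemma integral_translate:
  fixes f :: "'a::euclidean_space \<Rightarrow> 'b::{banach, second_countable_topology}"
  assumes "f \<in> borel_measurable borel"
  shows "(\<integral>x. f (x + s) \<partial>lborel) = (\<integral>x. f x \<partial>lborel)"
  using lborel_integral_affine[OF assms, of 1 s] by (simp add: add.commute)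

lemma integrable_translate:
  fixes f :: "'a::euclidean_space \<Rightarrow> 'b::{banach, second_countable_topology}"
  assumes f: "integrable lborel f"
  shows "integrable lborel (\<lambda>x. f (x + s))"
proof -
  have [measurable]: "f \<in> borel_measurable borel" using borel_measurable_integrable[OF f] by simp
  have "(\<integral>\<^sup>+x. ennreal (norm (f (x + s))) \<partial>lborel) = (\<integral>\<^sup>+x. ennreal (norm (f x)) \<partial>lborel)"
    by (rule nn_integral_translate[where f = "\<lambda>x. ennreal (norm (f x))"]) measurable
  then show ?thesis using f by (simp add: integrable_iff_bounded)
qed

lemma integrable_pair_mult:
  fixes f :: "'a::euclidean_space \<Rightarrow> real" and g :: "'b::euclidean_space \<Rightarrow> real"
  assumes f: "integrable lborel f" and g: "integrable lborel g"
  shows "integrable (lborel \<Otimes>\<^sub>M lborel) (\<lambda>z. f (fst z) * g (snd z))"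
proof (rule lborel_pair.Fubini_integrable)
  have [measurable]: "f \<in> borel_measurable borel" "g \<in> borel_measurable borel"
    using borel_measurable_integrable[OF f] borel_measurable_integrable[OF g] by simp_all
  show "(\<lambda>z. f (fst z) * g (snd z)) \<in> borel_measurable (lborel \<Otimes>\<^sub>M lborel)" by measurable
qed (use f g in \<open>simp_all add: abs_mult\<close>)

text \<open>
  An orthogonal complex structure: \<open>J\<close> is isometric, because it is skew and squares to \<open>-1\<close>. The
  instance of interest is right multiplication by \<open>i\<close> in the Clifford algebra.
\<close>

locale complex_structure =
  fixes J :: "'v::euclidean_space \<Rightarrow> 'v"
  assumes linear_J: "linear J"
    and J_J: "J (J v) = - v"
    and J_skew: "J u \<bullet> v = - (u \<bullet> J v)"
begin

text \<open>
  This is \<open>exp (- \<theta> J)\<close>; for right multiplication by \<open>i\<close> it is right multiplication by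
  \<open>exp (- i \<theta>)\<close>.
\<close>

definition rot :: "real \<Rightarrow> 'v \<Rightarrow> 'v" where
  "rot \<theta> v = cos \<theta> *\<^sub>R v - sin \<theta> *\<^sub>R J v"

lemma bounded_linear_J: "bounded_linear J"
  using linear_J by (rule linear_conv_bounded_linear[THEN iffD1])

lemma J_measurable [measurable]: "J \<in> borel_measurable borel"
  by (intro borel_measurable_continuous_onI linear_continuous_on bounded_linear_J)

lemma rot_measurable [measurable (raw)]:
  assumes [measurable]: "a \<in> borel_measurable M" "f \<in> borel_measurable M"
  shows "(\<lambda>x. rot (a x) (f x)) \<in> borel_measurable M"
  unfolding rot_def by measurable

lemma rot_inner: "rot a u \<bullet> rot b v = cos (a - b) * (u \<bullet> v) + sin (a - b) * (u \<bullet> J v)"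
proof -
  have "J u \<bullet> J v = u \<bullet> v" by (simp add: J_skew J_J)
  then show ?thesis
    unfolding rot_def by (simp add: inner_diff_left inner_diff_right J_skew cos_diff sin_diff algebra_simps)
qed

lemma norm_rot [simp]: "norm (rot a v) = norm v"
  by (simp add: norm_eq_sqrt_inner rot_inner)

lemma rot_inner_le: "\<bar>rot a u \<bullet> rot b v\<bar> \<le> norm u * norm v"
  using Cauchy_Schwarz_ineq2[of "rot a u" "rot b v"] by simp

lemma linear_rot: "linear (rot a)"
  unfolding rot_def
  by (intro linearI) (simp_all add: linear_add[OF linear_J] linear_scale[OF linear_J] algebra_simps)

lemma rot_diff: "rot a (u - v) = rot a u - rot a v"
  by (rule linear_diff[OF linear_rot])

lemma rot_add: "rot (a + b) v = rot a (rot b v)"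
  unfolding rot_def
  by (simp add: linear_diff[OF linear_J] linear_scale[OF linear_J] J_J cos_add sin_add algebra_simps)

text \<open>
  The chord \<open>2 |sin (a / 2)|\<close> is at most the arc \<open>|a|\<close>. This replaces the differentiation rule: it
  bounds the transform of a difference quotient by the linear weight.
\<close>

lemma norm_rot_diff_sq: "(norm (rot a v - v))\<^sup>2 \<le> a\<^sup>2 * (norm v)\<^sup>2"
proof -
  have "v \<bullet> J v = 0" using J_skew[of v v] by (simp add: inner_commute)
  then have "(norm (rot a v - v))\<^sup>2 = 2 * (1 - cos a) * (norm v)\<^sup>2"
    using rot_inner[of a v a v] rot_inner[of a v 0 v] rot_inner[of 0 v a v]
    by (simp add: power2_norm_eq_inner inner_diff_left inner_diff_right rot_def[of 0] algebra_simps)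
  also have "2 * (1 - cos a) \<le> a\<^sup>2"
  proof -
    have "2 * (1 - cos a) = (2 * sin (a / 2))\<^sup>2"
      using cos_double_sin[of "a / 2"] by (simp add: power2_eq_square)
    also have "\<dots> \<le> a\<^sup>2"
      using abs_sin_x_le_abs_x[of "a / 2"] by (intro abs_le_square_iff[THEN iffD1]) auto
    finally show ?thesis .
  qed
  finally show ?thesis by (simp add: mult_right_mono)
qed

definition ft :: "('a::euclidean_space \<Rightarrow> 'v) \<Rightarrow> 'a \<Rightarrow> 'v" where
  "ft f w = (\<integral>x. rot (x \<bullet> w) (f x) \<partial>lborel)"

lemma rot_integrable:
  fixes f :: "'a::euclidean_space \<Rightarrow> 'v"
  assumes f: "integrable lborel f"
  shows "integrable lborel (\<lambda>x. rot (x \<bullet> w) (f x))"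
proof (rule Bochner_Integration.integrable_bound[OF f])
  have [measurable]: "f \<in> borel_measurable borel" using borel_measurable_integrable[OF f] by simp
  show "(\<lambda>x. rot (x \<bullet> w) (f x)) \<in> borel_measurable lborel" by measurable
qed simp

lemma ft_measurable [measurable]:
  assumes [measurable]: "f \<in> borel_measurable borel"
  shows "ft f \<in> borel_measurable borel"
  unfolding ft_def[abs_def] by measurable

lemma ft_diff:
  assumes "integrable lborel f" "integrable lborel g"
  shows "ft (\<lambda>x. f x - g x) w = ft f w - ft g w"
  unfolding ft_def rot_diff using assms by (intro Bochner_Integration.integral_diff rot_integrable)

lemma ft_translate:
  fixes f :: "'a::euclidean_space \<Rightarrow> 'v"
  assumes f: "integrable lborel f"
  shows "ft (\<lambda>x. f (x + s)) w = rot (- (s \<bullet> w)) (ft f w)"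
proof -
  have [measurable]: "f \<in> borel_measurable borel" using borel_measurable_integrable[OF f] by simp
  have "ft (\<lambda>x. f (x + s)) w = (\<integral>x. rot ((x + s) \<bullet> w - s \<bullet> w) (f (x + s)) \<partial>lborel)"
    unfolding ft_def by (simp add: inner_add_left)
  also have "\<dots> = (\<integral>x. rot (x \<bullet> w - s \<bullet> w) (f x) \<partial>lborel)"
    by (rule integral_translate[where f = "\<lambda>x. rot (x \<bullet> w - s \<bullet> w) (f x)"]) measurable
  also have "\<dots> = (\<integral>x. rot (- (s \<bullet> w)) (rot (x \<bullet> w) (f x)) \<partial>lborel)"
    by (simp flip: rot_add)
  also have "\<dots> = rot (- (s \<bullet> w)) (ft f w)"
    unfolding ft_def using linear_rot[of "- (s \<bullet> w)", THEN linear_conv_bounded_linear[THEN iffD1]]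
    by (intro integral_bounded_linear rot_integrable f)
  finally show ?thesis .
qed

text \<open>
  Expanding the square of \<open>ft h w\<close> as a double integral over \<open>x\<close> and \<open>y\<close>, the integral over \<open>w\<close>
  can be carried out first. The sine part is odd and vanishes, the cosine part produces a Gaussian of
  width \<open>\<delta>\<close> in \<open>y - x\<close>. With \<open>y = x + \<delta> z\<close>, what remains is the Gaussian average over \<open>z\<close> of the
  correlation \<open>\<integral> h x \<bullet> h (x + \<delta> z) dx\<close>, which polarization expresses by the square integral of
  \<open>h (x + \<delta> z) - h x\<close>.
\<close>

lemma smoothed_plancherel:
  fixes h :: "'a::euclidean_space \<Rightarrow> 'v"
  assumes int: "integrable lborel h" and h: "energy h < \<infinity>" and \<delta>: "\<delta> > 0"
  shows "integrable lborel (\<lambda>w. gauss (\<delta> *\<^sub>R w) * (norm (ft h w))\<^sup>2)" (is ?A)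
    and "(\<integral>w. gauss (\<delta> *\<^sub>R w) * (norm (ft h w))\<^sup>2 \<partial>lborel) =
     sqrt (2 * pi) ^ DIM('a) * (\<integral>z. gauss z * ((\<integral>x. (norm (h x))\<^sup>2 \<partial>lborel) -
       (\<integral>x. (norm (h (x + \<delta> *\<^sub>R z) - h x))\<^sup>2 \<partial>lborel) / 2) \<partial>lborel)" (is ?B)
proof -
  have [measurable]: "h \<in> borel_measurable borel" using borel_measurable_integrable[OF int] by simp
  note sq = energy_eq_integral(1)[OF \<open>h \<in> borel_measurable borel\<close> h]
  define a where "a = (\<lambda>w p. gauss (\<delta> *\<^sub>R w) *
     (rot (fst p \<bullet> w) (h (fst p)) \<bullet> rot (snd p \<bullet> w) (h (snd p))))"
  define n where "n = (\<lambda>p::'a\<times>'a. norm (h (fst p)) * norm (h (snd p)))"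
  have n_int: "integrable lborel n"
    using integrable_pair_mult[of "\<lambda>x. norm (h x)" "\<lambda>x. norm (h x)"] int
    by (simp add: n_def lborel_prod)
  \<comment> \<open>the frequency \<open>w\<close> is the first variable, the pair \<open>p = (x, y)\<close> the second\<close>
  have [measurable]: "(\<lambda>p. a (fst p) (snd p)) \<in> borel_measurable (lborel \<Otimes>\<^sub>M lborel)"
  proof -
    have [measurable]: "(\<lambda>z::'a \<times> 'a \<times> 'a. fst z) \<in> borel_measurable borel"
        "(\<lambda>z::'a \<times> 'a \<times> 'a. fst (snd z)) \<in> borel_measurable borel"
        "(\<lambda>z::'a \<times> 'a \<times> 'a. snd (snd z)) \<in> borel_measurable borel"
      by (intro borel_measurable_continuous_onI continuous_intros)+
    have "(\<lambda>z. a (fst z) (snd z)) \<in> borel_measurable borel"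
      unfolding a_def by measurable
    then show ?thesis by (simp add: lborel_prod)
  qed
  have a_int: "integrable (lborel \<Otimes>\<^sub>M lborel) (\<lambda>z. a (fst z) (snd z))"
  proof (rule Bochner_Integration.integrable_bound[OF integrable_pair_mult[OF scaled_gauss_integrable[OF \<delta>] n_int]])
    show "AE z in lborel \<Otimes>\<^sub>M lborel. norm (a (fst z) (snd z)) \<le> norm (gauss (\<delta> *\<^sub>R fst z) * n (snd z))"
      unfolding a_def n_def norm_mult
      by (intro AE_I2 mult_left_mono) (simp_all add: rot_inner_le)
  qed measurable
  have ft_square: "(\<integral>p. a w p \<partial>lborel) = gauss (\<delta> *\<^sub>R w) * (norm (ft h w))\<^sup>2" for w
  proof -
    let ?r = "\<lambda>x. rot (x \<bullet> w) (h x)"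
    have r: "integrable lborel ?r" by (rule rot_integrable[OF int])
    have rr: "integrable (lborel \<Otimes>\<^sub>M lborel) (\<lambda>p. ?r (fst p) \<bullet> ?r (snd p))"
    proof (rule Bochner_Integration.integrable_bound[of _ n])
      show "integrable (lborel \<Otimes>\<^sub>M lborel) n" using n_int by (simp add: lborel_prod)
      show "AE p in lborel \<Otimes>\<^sub>M lborel. norm (?r (fst p) \<bullet> ?r (snd p)) \<le> norm (n p)"
        unfolding n_def by (intro AE_I2) (simp add: rot_inner_le)
    qed measurable
    have "(\<integral>p. ?r (fst p) \<bullet> ?r (snd p) \<partial>lborel) = (\<integral>x. (\<integral>y. ?r x \<bullet> ?r y \<partial>lborel) \<partial>lborel)"
      using lborel_pair.integral_fst'[OF rr] by (simp add: lborel_prod)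
    also have "\<dots> = ft h w \<bullet> ft h w"
      unfolding ft_def using r by simp
    finally show ?thesis by (simp add: a_def power2_norm_eq_inner)
  qed
  show ?A
    using lborel_pair.integrable_fst'[OF a_int] by (simp add: ft_square)
  have frequency_integral: "(\<integral>w. a w (x, y) \<partial>lborel) =
      sqrt (2 * pi) ^ DIM('a) / \<delta> ^ DIM('a) * (gauss ((y - x) /\<^sub>R \<delta>) * (h x \<bullet> h y))" for x y
  proof -
    have trig: "integrable lborel (\<lambda>w. gauss (\<delta> *\<^sub>R w) * cos (w \<bullet> (x - y)))"
         "integrable lborel (\<lambda>w. gauss (\<delta> *\<^sub>R w) * sin (w \<bullet> (x - y)))"
      by (rule Bochner_Integration.integrable_bound[OF scaled_gauss_integrable[OF \<delta>]],
          measurable, intro AE_I2, simp add: abs_mult mult_left_le)+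
    have "a w (x, y) = gauss (\<delta> *\<^sub>R w) * cos (w \<bullet> (x - y)) * (h x \<bullet> h y) +
        gauss (\<delta> *\<^sub>R w) * sin (w \<bullet> (x - y)) * (h x \<bullet> J (h y))" for w
      unfolding a_def by (simp add: rot_inner algebra_simps inner_commute)
    then have "(\<integral>w. a w (x, y) \<partial>lborel) = (\<integral>w. gauss (\<delta> *\<^sub>R w) * cos (w \<bullet> (x - y)) \<partial>lborel) * (h x \<bullet> h y) +
        (\<integral>w. gauss (\<delta> *\<^sub>R w) * sin (w \<bullet> (x - y)) \<partial>lborel) * (h x \<bullet> J (h y))"
      using trig by simp
    also have "(\<integral>w. gauss (\<delta> *\<^sub>R w) * sin (w \<bullet> (x - y)) \<partial>lborel) = 0"
      by (rule scaled_gauss_fourier(2)[OF \<delta>])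
    also have "(\<integral>w. gauss (\<delta> *\<^sub>R w) * cos (w \<bullet> (x - y)) \<partial>lborel) =
        sqrt (2 * pi) ^ DIM('a) / \<delta> ^ DIM('a) * gauss ((x - y) /\<^sub>R \<delta>)"
      using scaled_gauss_fourier(1)[OF \<delta>, of "x - y"] \<delta> by (simp add: field_simps)
    also have "gauss ((x - y) /\<^sub>R \<delta>) = gauss ((y - x) /\<^sub>R \<delta>)"
      using gauss_minus[of "(x - y) /\<^sub>R \<delta>"] by (simp flip: scaleR_minus_right)
    finally show ?thesis by simp
  qed
  define b where "b = (\<lambda>x z. gauss z * (h x \<bullet> h (x + \<delta> *\<^sub>R z)))"
  have inner_le: "\<bar>h x \<bullet> h y\<bar> \<le> ((norm (h x))\<^sup>2 + (norm (h y))\<^sup>2) / 2" for x y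
    using Cauchy_Schwarz_ineq2[of "h x" "h y"] sum_squares_bound[of "norm (h x)" "norm (h y)"]
    by simp
  have sq_shift: "integrable lborel (\<lambda>x. (norm (h (x + s)))\<^sup>2)" for s
    using integrable_translate[OF sq] by simp
  have sq_shift_eq: "(\<integral>x. (norm (h (x + s)))\<^sup>2 \<partial>lborel) = (\<integral>x. (norm (h x))\<^sup>2 \<partial>lborel)" for s
    by (rule integral_translate[where f = "\<lambda>x. (norm (h x))\<^sup>2"]) measurable
  have inner_int: "integrable lborel (\<lambda>x. h x \<bullet> h (x + s))" for s
    by (rule Bochner_Integration.integrable_bound[of _ "\<lambda>x. ((norm (h x))\<^sup>2 + (norm (h (x + s)))\<^sup>2) / 2"])
      (use sq sq_shift inner_le in \<open>simp_all add: mult.commute\<close>)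
  have [measurable]: "(\<lambda>p. b (snd p) (fst p)) \<in> borel_measurable (lborel \<Otimes>\<^sub>M lborel)"
    unfolding b_def by measurable
  have "integrable (lborel \<Otimes>\<^sub>M lborel) (\<lambda>p. b (snd p) (fst p))"
  proof (rule lborel_pair.Fubini_integrable)
    show "integrable lborel (\<lambda>z. \<integral>x. norm (b (snd (z, x)) (fst (z, x))) \<partial>lborel)"
    proof (rule Bochner_Integration.integrable_bound[of _ "\<lambda>z. gauss z * (\<integral>x. (norm (h x))\<^sup>2 \<partial>lborel)"])
      show "(\<lambda>z. \<integral>x. norm (b (snd (z, x)) (fst (z, x))) \<partial>lborel) \<in> borel_measurable lborel"
        unfolding b_def by measurable
      have "norm (\<integral>x. norm (b x z) \<partial>lborel) \<le> norm (gauss z * (\<integral>x. (norm (h x))\<^sup>2 \<partial>lborel))" for z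
      proof -
        have "norm (\<integral>x. norm (b x z) \<partial>lborel) = gauss z * (\<integral>x. \<bar>h x \<bullet> h (x + \<delta> *\<^sub>R z)\<bar> \<partial>lborel)"
          unfolding b_def by (simp add: abs_mult abs_of_pos[OF gauss_pos] integral_nonneg_AE)
        also have "\<dots> \<le> gauss z * (\<integral>x. ((norm (h x))\<^sup>2 + (norm (h (x + \<delta> *\<^sub>R z)))\<^sup>2) / 2 \<partial>lborel)"
          using inner_int sq sq_shift
          by (intro mult_left_mono integral_mono inner_le) (auto simp: less_imp_le[OF gauss_pos])
        also have "(\<integral>x. ((norm (h x))\<^sup>2 + (norm (h (x + \<delta> *\<^sub>R z)))\<^sup>2) / 2 \<partial>lborel) = (\<integral>x. (norm (h x))\<^sup>2 \<partial>lborel)"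
          using sq sq_shift by (simp add: sq_shift_eq)
        finally show ?thesis by simp
      qed
      then show "AE z in lborel. norm (\<integral>x. norm (b (snd (z, x)) (fst (z, x))) \<partial>lborel)
          \<le> norm (gauss z * (\<integral>x. (norm (h x))\<^sup>2 \<partial>lborel))" by simp
    qed simp
    show "AE z in lborel. integrable lborel (\<lambda>x. b (snd (z, x)) (fst (z, x)))"
      using inner_int by (simp add: b_def)
  qed measurable
  then have b_int: "integrable (lborel \<Otimes>\<^sub>M lborel) (\<lambda>(z, x). b x z)"
    by (simp add: case_prod_unfold)
  have correlation_eq: "(\<integral>x. b x z \<partial>lborel) = gauss z * ((\<integral>x. (norm (h x))\<^sup>2 \<partial>lborel) -
       (\<integral>x. (norm (h (x + \<delta> *\<^sub>R z) - h x))\<^sup>2 \<partial>lborel) / 2)" for z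
  proof -
    have "(norm (h (x + \<delta> *\<^sub>R z) - h x))\<^sup>2 =
        (norm (h (x + \<delta> *\<^sub>R z)))\<^sup>2 + (norm (h x))\<^sup>2 - 2 * (h x \<bullet> h (x + \<delta> *\<^sub>R z))" for x
      by (simp add: power2_norm_eq_inner inner_diff_left inner_diff_right inner_commute)
    then have "(\<integral>x. (norm (h (x + \<delta> *\<^sub>R z) - h x))\<^sup>2 \<partial>lborel) =
        2 * (\<integral>x. (norm (h x))\<^sup>2 \<partial>lborel) - 2 * (\<integral>x. h x \<bullet> h (x + \<delta> *\<^sub>R z) \<partial>lborel)"
      using sq sq_shift inner_int by (simp add: sq_shift_eq)
    then show ?thesis by (simp add: b_def diff_divide_distrib)
  qed
  have gauss_le: "gauss x \<le> (1 / sqrt (2 * pi)) ^ DIM('a)" for x :: 'a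
    unfolding gauss_eq by (rule mult_left_le) auto
  have "(\<integral>w. gauss (\<delta> *\<^sub>R w) * (norm (ft h w))\<^sup>2 \<partial>lborel) = (\<integral>w. (\<integral>p. a w p \<partial>lborel) \<partial>lborel)"
    by (simp add: ft_square)
  also have "\<dots> = (\<integral>p. (\<integral>w. a w p \<partial>lborel) \<partial>lborel)"
    using lborel_pair.Fubini_integral[of a] a_int by (simp add: case_prod_unfold)
  also have "\<dots> = (\<integral>p. sqrt (2 * pi) ^ DIM('a) / \<delta> ^ DIM('a) *
      (gauss ((snd p - fst p) /\<^sub>R \<delta>) * (h (fst p) \<bullet> h (snd p))) \<partial>lborel)"
    by (intro Bochner_Integration.integral_cong refl) (metis frequency_integral prod.collapse)
  also have "\<dots> = sqrt (2 * pi) ^ DIM('a) / \<delta> ^ DIM('a) *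
      (\<integral>p. gauss ((snd p - fst p) /\<^sub>R \<delta>) * (h (fst p) \<bullet> h (snd p)) \<partial>lborel)"
    by simp
  also have "(\<integral>p. gauss ((snd p - fst p) /\<^sub>R \<delta>) * (h (fst p) \<bullet> h (snd p)) \<partial>lborel) =
      (\<integral>x. (\<integral>y. gauss ((y - x) /\<^sub>R \<delta>) * (h x \<bullet> h y) \<partial>lborel) \<partial>lborel)"
  proof -
    have "integrable (lborel \<Otimes>\<^sub>M lborel) (\<lambda>p. gauss ((snd p - fst p) /\<^sub>R \<delta>) * (h (fst p) \<bullet> h (snd p)))"
    proof (rule Bochner_Integration.integrable_bound[of _ "\<lambda>p. (1 / sqrt (2 * pi)) ^ DIM('a) * n p"])
      show "integrable (lborel \<Otimes>\<^sub>M lborel) (\<lambda>p. (1 / sqrt (2 * pi)) ^ DIM('a) * n p)"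
        using n_int by (simp add: lborel_prod)
      show "AE p in lborel \<Otimes>\<^sub>M lborel. norm (gauss ((snd p - fst p) /\<^sub>R \<delta>) * (h (fst p) \<bullet> h (snd p)))
          \<le> norm ((1 / sqrt (2 * pi)) ^ DIM('a) * n p)"
      proof (rule AE_I2)
        fix p :: "'a \<times> 'a"
        have "norm (gauss ((snd p - fst p) /\<^sub>R \<delta>) * (h (fst p) \<bullet> h (snd p))) \<le> (1 / sqrt (2 * pi)) ^ DIM('a) * n p"
          unfolding n_def real_norm_def abs_mult abs_of_pos[OF gauss_pos]
          by (intro mult_mono gauss_le Cauchy_Schwarz_ineq2) auto
        then show "norm (gauss ((snd p - fst p) /\<^sub>R \<delta>) * (h (fst p) \<bullet> h (snd p)))
          \<le> norm ((1 / sqrt (2 * pi)) ^ DIM('a) * n p)" by simp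
      qed
    qed measurable
    from lborel_pair.integral_fst'[OF this] show ?thesis by (simp add: lborel_prod)
  qed
  also have "\<dots> = (\<integral>x. \<delta> ^ DIM('a) * (\<integral>z. b x z \<partial>lborel) \<partial>lborel)"
  proof (intro Bochner_Integration.integral_cong refl)
    fix x
    have "(\<integral>y. gauss ((y - x) /\<^sub>R \<delta>) * (h x \<bullet> h y) \<partial>lborel) =
        \<delta> ^ DIM('a) *\<^sub>R (\<integral>z. gauss ((x + \<delta> *\<^sub>R z - x) /\<^sub>R \<delta>) * (h x \<bullet> h (x + \<delta> *\<^sub>R z)) \<partial>lborel)"
      by (rule lborel_integral_affine[where f = "\<lambda>y. gauss ((y - x) /\<^sub>R \<delta>) * (h x \<bullet> h y)", OF _ \<delta>]) measurable
    then show "(\<integral>y. gauss ((y - x) /\<^sub>R \<delta>) * (h x \<bullet> h y) \<partial>lborel) = \<delta> ^ DIM('a) * (\<integral>z. b x z \<partial>lborel)"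
      using \<delta> by (simp add: b_def)
  qed
  also have "\<dots> = \<delta> ^ DIM('a) * (\<integral>x. (\<integral>z. b x z \<partial>lborel) \<partial>lborel)" by simp
  also have "(\<integral>x. (\<integral>z. b x z \<partial>lborel) \<partial>lborel) = (\<integral>z. (\<integral>x. b x z \<partial>lborel) \<partial>lborel)"
    using lborel_pair.Fubini_integral[OF b_int] by simp
  finally show ?B using \<delta> by (simp add: correlation_eq)
qed

end


section \<open>The Plancherel theorem\<close>

text \<open>
  The approximating sequences through which the transform is extended: on a ball, \<open>|f| \<le> 1 + |f|\<^sup>2\<close>
  is integrable.
\<close>

lemma ball_truncation:
  fixes f :: "'a::euclidean_space \<Rightarrow> 'v::euclidean_space"
  assumes [measurable]: "f \<in> borel_measurable borel" and f: "energy f < \<infinity>"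
  shows "\<exists>c. (\<forall>k::nat. integrable lborel (c k) \<and> energy (c k) < \<infinity>) \<and>
     (\<lambda>k. energy (\<lambda>x. c k x - f x)) \<longlonglongrightarrow> 0"
proof (intro exI conjI allI)
  let ?c = "\<lambda>k::nat. \<lambda>x. indicator (cball 0 (real k)) x *\<^sub>R f x"
  have [measurable]: "cball (0::'a) (real k) \<in> sets borel" for k by simp
  show "integrable lborel (?c k)" for k
  proof (rule Bochner_Integration.integrable_bound)
    show "integrable lborel (\<lambda>x. indicator (cball (0::'a) (real k)) x + (norm (f x))\<^sup>2 :: real)"
      using emeasure_lborel_cball_finite[of "0::'a" "real k"] energy_eq_integral(1)[OF assms]
      by (intro Bochner_Integration.integrable_add) (auto simp: less_top)
    show "AE x in lborel. norm (?c k x) \<le> norm (indicator (cball 0 (real k)) x + (norm (f x))\<^sup>2 :: real)"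
    proof (rule AE_I2)
      fix x
      have "norm (f x) \<le> 1 + (norm (f x))\<^sup>2"
        using sum_squares_bound[of "norm (f x)" 1] zero_le_power2[of "norm (f x)"] norm_ge_zero[of "f x"]
        unfolding power_one by linarith
      then show "norm (?c k x) \<le> norm (indicator (cball 0 (real k)) x + (norm (f x))\<^sup>2 :: real)"
        by (auto simp: indicator_def)
    qed
  qed measurable
  have "energy (?c k) \<le> energy f" for k
    by (rule energy_mono) (auto simp: indicator_def)
  then show "energy (?c k) < \<infinity>" for k
    using f by (rule le_less_trans)
  show "(\<lambda>k. energy (\<lambda>x. ?c k x - f x)) \<longlonglongrightarrow> 0"
  proof (rule energy_truncate_tendsto)
    fix x :: 'a
    obtain n where n: "norm x \<le> real n" using real_arch_simple by blast
    show "eventually (\<lambda>k. x \<in> cball 0 (real k)) sequentially"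
      using eventually_ge_at_top[of n] by eventually_elim (use n in auto)
  qed (use f in auto)
qed

context complex_structure
begin

text \<open>
  Let \<open>\<delta>\<close> decrease to 0 in \<open>smoothed_plancherel\<close>. On the frequency side the weights increase to a
  constant, so that monotone convergence applies even though the integral is not yet known to be
  finite; on the other side the average of the increments disappears by continuity of translations.
\<close>

theorem plancherel:
  fixes h :: "'a::euclidean_space \<Rightarrow> 'v"
  assumes int: "integrable lborel h" and h: "energy h < \<infinity>"
  shows "energy (ft h) = ennreal ((2 * pi) ^ DIM('a)) * energy h"
proof -
  have [measurable]: "h \<in> borel_measurable borel" using borel_measurable_integrable[OF int] by simp
  define E where "E = (\<integral>x. (norm (h x))\<^sup>2 \<partial>lborel)"
  define T where "T = (\<lambda>s. \<integral>x. (norm (h (x + s) - h x))\<^sup>2 \<partial>lborel)"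
  define C where "C = sqrt (2 * pi) ^ DIM('a)"
  define \<delta> where "\<delta> = (\<lambda>k. 1 / real (Suc k))"
  have \<delta>_pos: "\<delta> k > 0" for k by (simp add: \<delta>_def)
  have \<delta>_lim: "\<delta> \<longlonglongrightarrow> 0"
    unfolding \<delta>_def by (rule LIMSEQ_Suc[OF lim_1_over_n])
  have C_pos: "C > 0" by (simp add: C_def)
  have hE: "energy h = ennreal E" unfolding E_def by (rule energy_eq_integral(2)[OF _ h]) measurable
  have E_nonneg: "0 \<le> E" unfolding E_def by simp
  have T_nonneg: "0 \<le> T s" for s unfolding T_def by simp
  have shift_le: "energy (\<lambda>x. h (x + s) - h x) \<le> ennreal (4 * E)" for s
  proof -
    have "energy (\<lambda>x. h (x + s) - h x) \<le> 2 * energy (\<lambda>x. h (x + s)) + 2 * energy h"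
      by (rule energy_diff_le2) measurable
    also have "\<dots> = 2 * energy h + 2 * energy h" by (simp add: energy_translate)
    also have "\<dots> = ennreal (4 * E)"
      using E_nonneg by (simp add: hE numeral_mult_ennreal ennreal_plus[symmetric] del: ennreal_plus)
    finally show ?thesis .
  qed
  have T: "energy (\<lambda>x. h (x + s) - h x) = ennreal (T s)" for s
    unfolding T_def
    by (rule energy_eq_integral(2)) (measurable, rule le_less_trans[OF shift_le], simp)
  have T_le: "T s \<le> 4 * E" for s
    using shift_le[of s] E_nonneg unfolding T by (simp add: ennreal_le_iff)
  have T_lim: "(\<lambda>k. T (\<delta> k *\<^sub>R z)) \<longlonglongrightarrow> 0" for z
  proof -
    have "(\<lambda>k. \<delta> k *\<^sub>R z) \<longlonglongrightarrow> 0" using tendsto_scaleR[OF \<delta>_lim tendsto_const[of z]] by simp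
    from translation_continuous[OF _ h this] have "(\<lambda>k. ennreal (T (\<delta> k *\<^sub>R z))) \<longlonglongrightarrow> ennreal 0"
      by (simp add: T)
    then show ?thesis by (subst (asm) tendsto_ennreal_iff) (auto simp: T_nonneg)
  qed
  have [measurable]: "T \<in> borel_measurable borel" unfolding T_def by measurable
  have "(\<lambda>k. \<integral>z. gauss z * (E - T (\<delta> k *\<^sub>R z) / 2) \<partial>lborel) \<longlonglongrightarrow> (\<integral>z. gauss (z::'a) * E \<partial>lborel)"
  proof (rule integral_dominated_convergence[where w = "\<lambda>z::'a. gauss z * E"])
    show "AE z in lborel. norm (gauss z * (E - T (\<delta> k *\<^sub>R z) / 2)) \<le> gauss z * E" for k
    proof (rule AE_I2)
      fix z
      have "\<bar>E - T (\<delta> k *\<^sub>R z) / 2\<bar> \<le> E"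
        using T_le[of "\<delta> k *\<^sub>R z"] T_nonneg[of "\<delta> k *\<^sub>R z"] by (auto simp: abs_le_iff)
      then show "norm (gauss z * (E - T (\<delta> k *\<^sub>R z) / 2)) \<le> gauss z * E"
        by (simp add: abs_mult abs_of_pos[OF gauss_pos] gauss_pos)
    qed
    show "AE z in lborel. (\<lambda>k. gauss z * (E - T (\<delta> k *\<^sub>R z) / 2)) \<longlonglongrightarrow> gauss z * E"
    proof (rule AE_I2)
      fix z
      have "(\<lambda>k. gauss z * (E - T (\<delta> k *\<^sub>R z) / 2)) \<longlonglongrightarrow> gauss z * (E - 0 / 2)"
        by (intro tendsto_intros T_lim) simp
      then show "(\<lambda>k. gauss z * (E - T (\<delta> k *\<^sub>R z) / 2)) \<longlonglongrightarrow> gauss z * E" by simp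
    qed
  qed measurable
  then have "(\<lambda>k. C * (C * (\<integral>z. gauss z * (E - T (\<delta> k *\<^sub>R z) / 2) \<partial>lborel))) \<longlonglongrightarrow> C * (C * E)"
    by (intro tendsto_intros) (simp add: gauss_integral)
  moreover have "(\<integral>w. gauss (\<delta> k *\<^sub>R w) * (norm (ft h w))\<^sup>2 \<partial>lborel) =
      C * (\<integral>z. gauss z * (E - T (\<delta> k *\<^sub>R z) / 2) \<partial>lborel)" for k
    unfolding C_def E_def T_def by (rule smoothed_plancherel(2)[OF int h \<delta>_pos])
  ultimately have "(\<lambda>k. C * (\<integral>w. gauss (\<delta> k *\<^sub>R w) * (norm (ft h w))\<^sup>2 \<partial>lborel)) \<longlonglongrightarrow> C * (C * E)"
    by simp
  then have lim1: "(\<lambda>k. ennreal (C * (\<integral>w. gauss (\<delta> k *\<^sub>R w) * (norm (ft h w))\<^sup>2 \<partial>lborel))) \<longlonglongrightarrow> ennreal (C * (C * E))"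
    by (rule tendsto_ennrealI)
  \<comment> \<open>the weights, normalized to increase to 1\<close>
  have C_gauss: "C * gauss w = exp (- (norm w)\<^sup>2 / 2)" for w :: 'a
    by (simp add: C_def gauss_eq power_one_over)
  have "ennreal (C * (\<integral>w. gauss (\<delta> k *\<^sub>R w) * (norm (ft h w))\<^sup>2 \<partial>lborel)) =
      (\<integral>\<^sup>+w. ennreal (exp (- (norm (\<delta> k *\<^sub>R w))\<^sup>2 / 2) * (norm (ft h w))\<^sup>2) \<partial>lborel)" for k
  proof -
    have "C * (\<integral>w. gauss (\<delta> k *\<^sub>R w) * (norm (ft h w))\<^sup>2 \<partial>lborel) =
       (\<integral>w. exp (- (norm (\<delta> k *\<^sub>R w))\<^sup>2 / 2) * (norm (ft h w))\<^sup>2 \<partial>lborel)"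
      unfolding C_gauss[symmetric] by (simp add: mult.assoc)
    moreover have "integrable lborel (\<lambda>w. exp (- (norm (\<delta> k *\<^sub>R w))\<^sup>2 / 2) * (norm (ft h w))\<^sup>2)"
      unfolding C_gauss[symmetric] mult.assoc
      by (intro integrable_mult_right smoothed_plancherel(1)[OF int h \<delta>_pos])
    ultimately show ?thesis by (simp add: nn_integral_eq_integral)
  qed
  moreover have "(\<lambda>k. \<integral>\<^sup>+w. ennreal (exp (- (norm (\<delta> k *\<^sub>R w))\<^sup>2 / 2) * (norm (ft h w))\<^sup>2) \<partial>lborel)
      \<longlonglongrightarrow> energy (ft h)"
    unfolding energy_def
  proof (rule nn_integral_LIMSEQ)
    show "incseq (\<lambda>k w. ennreal (exp (- (norm (\<delta> k *\<^sub>R w))\<^sup>2 / 2) * (norm (ft h w))\<^sup>2))"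
    proof (intro incseq_SucI le_funI ennreal_leI mult_right_mono)
      fix k and w :: 'a
      have "norm (\<delta> (Suc k) *\<^sub>R w) \<le> norm (\<delta> k *\<^sub>R w)"
        by (auto simp: \<delta>_def intro!: mult_right_mono divide_left_mono)
      then show "exp (- (norm (\<delta> k *\<^sub>R w))\<^sup>2 / 2) \<le> exp (- (norm (\<delta> (Suc k) *\<^sub>R w))\<^sup>2 / 2)"
        by (simp add: power_mono)
    qed simp
    fix w
    have "(\<lambda>k. exp (- (norm (\<delta> k *\<^sub>R w))\<^sup>2 / 2) * (norm (ft h w))\<^sup>2) \<longlonglongrightarrow>
        exp (- (norm (0 *\<^sub>R w))\<^sup>2 / 2) * (norm (ft h w))\<^sup>2"
      by (intro tendsto_intros \<delta>_lim) simp
    then show "(\<lambda>k. ennreal (exp (- (norm (\<delta> k *\<^sub>R w))\<^sup>2 / 2) * (norm (ft h w))\<^sup>2)) \<longlonglongrightarrow>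
        ennreal ((norm (ft h w))\<^sup>2)"
      by (intro tendsto_ennrealI) simp
  qed measurable
  ultimately have "energy (ft h) = ennreal (C * (C * E))"
    using LIMSEQ_unique[OF _ lim1] by simp
  also have "C * (C * E) = (2 * pi) ^ DIM('a) * E"
    unfolding C_def mult.assoc[symmetric] power_mult_distrib[symmetric] by simp
  finally show ?thesis using E_nonneg by (simp add: hE ennreal_mult)
qed

lemma energy_ft_diff:
  fixes f :: "'a::euclidean_space \<Rightarrow> 'v"
  assumes f: "integrable lborel f" "energy f < \<infinity>" and g: "integrable lborel g" "energy g < \<infinity>"
  shows "energy (\<lambda>w. ft f w - ft g w) = ennreal ((2 * pi) ^ DIM('a)) * energy (\<lambda>x. f x - g x)"
proof -
  have "energy (\<lambda>x. f x - g x) \<le> 2 * energy f + 2 * energy g"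
    using f g by (intro energy_diff_le2) (auto dest: borel_measurable_integrable)
  also have "\<dots> < \<infinity>" using f g by (simp add: ennreal_mult_less_top)
  finally have "energy (ft (\<lambda>x. f x - g x)) = ennreal ((2 * pi) ^ DIM('a)) * energy (\<lambda>x. f x - g x)"
    using f g by (intro plancherel) auto
  then show ?thesis using f g by (simp add: ft_diff energy_def)
qed

text \<open>
  A relation and not a function, because the extension of the transform to \<open>L\<^sup>2\<close> is determined only
  up to null sets.
\<close>

definition is_ft_L2 :: "('a::euclidean_space \<Rightarrow> 'v) \<Rightarrow> ('a \<Rightarrow> 'v) \<Rightarrow> bool" where
  "is_ft_L2 f g \<longleftrightarrow> (\<forall>h. (\<forall>m. integrable lborel (h m) \<and> energy (h m) < \<infinity>) \<longrightarrow>
     (\<lambda>m::nat. energy (\<lambda>x. h m x - f x)) \<longlonglongrightarrow> 0 \<longrightarrow> (\<lambda>m. energy (\<lambda>w. ft (h m) w - g w)) \<longlonglongrightarrow> 0)"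

text \<open>
  Choose truncations that approach \<open>f\<close> geometrically fast. By Plancherel their transforms have the
  Cauchy rate that \<open>square_integrable_complete\<close> asks for, and any other approximating sequence has
  transforms close to these.
\<close>

lemma ft_L2_exists:
  fixes f :: "'a::euclidean_space \<Rightarrow> 'v"
  assumes [measurable]: "f \<in> borel_measurable borel" and f: "energy f < \<infinity>"
  shows "\<exists>g\<in>borel_measurable borel. energy g < \<infinity> \<and> is_ft_L2 f g"
proof -
  let ?K = "ennreal ((2 * pi) ^ DIM('a))"
  obtain c where c: "\<And>k::nat. integrable lborel (c k)" "\<And>k. energy (c k) < \<infinity>"
      "(\<lambda>k. energy (\<lambda>x. c k x - f x)) \<longlonglongrightarrow> 0"
    using ball_truncation[OF assms] by blast
  have "\<exists>m. energy (\<lambda>x. c m x - f x) \<le> ennreal ((1/8) ^ k)" for k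
    using order_tendstoD(2)[OF c(3), of "ennreal ((1/8) ^ k)"]
    by (auto simp: eventually_sequentially intro: less_imp_le)
  then obtain r where r: "\<And>k. energy (\<lambda>x. c (r k) x - f x) \<le> ennreal ((1/8) ^ k)" by metis
  have c_meas[measurable]: "c k \<in> borel_measurable borel" for k
    using borel_measurable_integrable[OF c(1)] by simp
  define u where "u = (\<lambda>k. ft (c (r k)))"
  have [measurable]: "u k \<in> borel_measurable borel" for k unfolding u_def by measurable
  have "\<exists>g\<in>borel_measurable borel. (\<lambda>k. energy (\<lambda>x. u k x - g x)) \<longlonglongrightarrow> 0"
  proof (rule square_integrable_complete[where C = "?K * 4"])
    fix j k :: nat assume "k \<le> j"
    have "energy (\<lambda>x. c (r j) x - c (r k) x) \<le>
        2 * energy (\<lambda>x. c (r j) x - f x) + 2 * energy (\<lambda>x. f x - c (r k) x)"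
      by (rule energy_triangle2) measurable
    also have "\<dots> \<le> 2 * ennreal ((1/8) ^ k) + 2 * ennreal ((1/8) ^ k)"
    proof (intro add_mono mult_left_mono)
      show "energy (\<lambda>x. c (r j) x - f x) \<le> ennreal ((1/8) ^ k)"
        using \<open>k \<le> j\<close> by (intro order_trans[OF r] ennreal_leI power_decreasing) auto
      show "energy (\<lambda>x. f x - c (r k) x) \<le> ennreal ((1/8) ^ k)"
        using r[of k] by (simp add: energy_minus_commute)
    qed auto
    also have "\<dots> = 4 * ennreal ((1/8) ^ k)" by (simp flip: distrib_right)
    finally show "energy (\<lambda>x. u j x - u k x) \<le> ?K * 4 * ennreal ((1/8) ^ k)"
      unfolding u_def energy_ft_diff[OF c(1,2) c(1,2)] mult.assoc by (intro mult_left_mono) auto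
  qed (auto simp: ennreal_mult_less_top)
  then obtain g where [measurable]: "g \<in> borel_measurable borel"
    and g: "(\<lambda>k. energy (\<lambda>x. u k x - g x)) \<longlonglongrightarrow> 0" by blast
  have r_lim: "(\<lambda>k. energy (\<lambda>x. c (r k) x - f x)) \<longlonglongrightarrow> 0"
  proof (rule tendsto_sandwich[OF _ _ tendsto_const])
    show "(\<lambda>k. ennreal ((1/8) ^ k)) \<longlonglongrightarrow> 0"
      unfolding ennreal_0[symmetric] by (intro tendsto_ennrealI LIMSEQ_power_zero) auto
  qed (auto simp: r)
  have "is_ft_L2 f g"
    unfolding is_ft_L2_def
  proof (intro allI impI)
    fix h assume h: "\<forall>m. integrable lborel (h m) \<and> energy (h m) < \<infinity>"
      and lim: "(\<lambda>m::nat. energy (\<lambda>x. h m x - f x)) \<longlonglongrightarrow> 0"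
    have [measurable]: "h m \<in> borel_measurable borel" for m
      using h borel_measurable_integrable[of lborel "h m"] by simp
    have le: "energy (\<lambda>w. ft (h m) w - g w) \<le>
        2 * (?K * (2 * energy (\<lambda>x. h m x - f x) + 2 * energy (\<lambda>x. c (r m) x - f x))) + 2 * energy (\<lambda>x. u m x - g x)" for m
    proof -
      have "energy (\<lambda>w. ft (h m) w - g w) \<le> 2 * energy (\<lambda>w. ft (h m) w - u m w) + 2 * energy (\<lambda>x. u m x - g x)"
        by (rule energy_triangle2) measurable
      also have "energy (\<lambda>w. ft (h m) w - u m w) = ?K * energy (\<lambda>x. h m x - c (r m) x)"
        unfolding u_def using h by (intro energy_ft_diff c) auto
      also have "energy (\<lambda>x. h m x - c (r m) x) \<le> 2 * energy (\<lambda>x. h m x - f x) + 2 * energy (\<lambda>x. f x - c (r m) x)"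
        by (rule energy_triangle2) measurable
      finally show ?thesis by (simp add: energy_minus_commute[of f] mult_left_mono add_right_mono)
    qed
    have "(\<lambda>m. 2 * (?K * (2 * energy (\<lambda>x. h m x - f x) + 2 * energy (\<lambda>x. c (r m) x - f x))) +
        2 * energy (\<lambda>x. u m x - g x)) \<longlonglongrightarrow> 2 * (?K * (2 * 0 + 2 * 0)) + 2 * 0"
      by (intro tendsto_add ennreal_tendsto_cmult lim r_lim g) auto
    then have lim0: "(\<lambda>m. 2 * (?K * (2 * energy (\<lambda>x. h m x - f x) + 2 * energy (\<lambda>x. c (r m) x - f x))) +
        2 * energy (\<lambda>x. u m x - g x)) \<longlonglongrightarrow> 0" by simp
    show "(\<lambda>m. energy (\<lambda>w. ft (h m) w - g w)) \<longlonglongrightarrow> 0"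
      by (rule tendsto_sandwich[OF _ _ tendsto_const lim0]) (intro always_eventually allI le zero_le)+
  qed
  moreover have "energy g < \<infinity>"
  proof -
    have "eventually (\<lambda>k. energy (\<lambda>x. u k x - g x) < 1) sequentially"
      by (rule order_tendstoD(2)[OF g]) simp
    then obtain k where k: "energy (\<lambda>x. u k x - g x) < 1" by (auto simp: eventually_sequentially)
    have "energy g = energy (\<lambda>x. u k x - (u k x - g x))" by simp
    also have "\<dots> \<le> 2 * energy (u k) + 2 * energy (\<lambda>x. u k x - g x)"
      by (rule energy_diff_le2) measurable
    also have "energy (u k) = ?K * energy (c (r k))"
      unfolding u_def by (intro plancherel c)
    also have "2 * (?K * energy (c (r k))) + 2 * energy (\<lambda>x. u k x - g x) < \<infinity>"
      using c(2)[of "r k"] less_trans[OF k ennreal_one_less_top] by (simp add: ennreal_mult_less_top)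
    finally show ?thesis .
  qed
  ultimately show ?thesis by (intro bexI[of _ g]) auto
qed

text \<open>
  Half of the Plancherel identity on \<open>L\<^sup>2\<close>, for \<open>f\<close> and for the increments of \<open>f\<close>. Both hold with
  equality for truncations of \<open>f\<close> by \<open>plancherel\<close> and \<open>ft_translate\<close>, and pass to the limit by
  \<open>energy_le_limit\<close>.
\<close>

lemma
  fixes f :: "'a::euclidean_space \<Rightarrow> 'v"
  assumes [measurable]: "f \<in> borel_measurable borel" "g \<in> borel_measurable borel"
    and f: "energy f < \<infinity>" and ft: "is_ft_L2 f g"
  shows energy_le_ft_L2: "energy f \<le> ennreal (1 / (2 * pi) ^ DIM('a)) * energy g" (is ?A)
    and energy_shift_le_ft_L2: "energy (\<lambda>x. f (x + s) - f x) \<le>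
       ennreal (1 / (2 * pi) ^ DIM('a)) * energy (\<lambda>w. rot (- (s \<bullet> w)) (g w) - g w)" (is ?B)
proof -
  let ?K = "ennreal ((2 * pi) ^ DIM('a))" and ?C = "ennreal (1 / (2 * pi) ^ DIM('a))"
  have CK: "?C * (?K * y) = y" for y
    unfolding mult.assoc[symmetric] by (subst ennreal_mult[symmetric]) auto
  obtain c where c: "\<And>k::nat. integrable lborel (c k)" "\<And>k. energy (c k) < \<infinity>"
      and c_lim: "(\<lambda>k. energy (\<lambda>x. c k x - f x)) \<longlonglongrightarrow> 0"
    using ball_truncation[OF assms(1) f] by blast
  have ft_lim: "(\<lambda>k. energy (\<lambda>w. ft (c k) w - g w)) \<longlonglongrightarrow> 0"
    using ft c c_lim unfolding is_ft_L2_def by blast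
  have [measurable]: "c k \<in> borel_measurable borel" for k
    using borel_measurable_integrable[OF c(1)] by simp
  show ?A
  proof (rule energy_le_limit[where u\<^sub>m = c and v\<^sub>m = "\<lambda>k. ft (c k)"])
    show "energy (c m) \<le> ?C * energy (ft (c m))" for m
      by (simp only: plancherel[OF c] CK order_refl)
  qed (use c_lim ft_lim in auto)
  show ?B
  proof (rule energy_le_limit[where u\<^sub>m = "\<lambda>k x. c k (x + s) - c k x"
        and v\<^sub>m = "\<lambda>k w. rot (- (s \<bullet> w)) (ft (c k) w) - ft (c k) w"])
    show "energy (\<lambda>x. c m (x + s) - c m x) \<le> ?C * energy (\<lambda>w. rot (- (s \<bullet> w)) (ft (c m) w) - ft (c m) w)" for m
    proof -
      have "energy (\<lambda>w. ft (\<lambda>x. c m (x + s)) w - ft (c m) w) = ?K * energy (\<lambda>x. c m (x + s) - c m x)"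
        using c by (intro energy_ft_diff integrable_translate) (auto simp: energy_translate)
      then show ?thesis by (simp only: ft_translate[OF c(1)] CK order_refl)
    qed
    have tendsto_0_of_le: "(\<lambda>k. e k) \<longlonglongrightarrow> 0" if "d \<longlonglongrightarrow> 0" "\<And>k. e k \<le> 2 * d k + 2 * d k" for d e :: "nat \<Rightarrow> ennreal"
    proof (rule tendsto_sandwich[OF _ _ tendsto_const])
      have "(\<lambda>k. 2 * d k + 2 * d k) \<longlonglongrightarrow> 2 * 0 + 2 * 0"
        by (intro tendsto_add ennreal_tendsto_cmult that) auto
      then show "(\<lambda>k. 2 * d k + 2 * d k) \<longlonglongrightarrow> 0" by simp
    qed (use that in auto)
    show "(\<lambda>m. energy (\<lambda>x. (c m (x + s) - c m x) - (f (x + s) - f x))) \<longlonglongrightarrow> 0"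
    proof (rule tendsto_0_of_le[OF c_lim])
      fix k
      have "energy (\<lambda>x. (c k (x + s) - c k x) - (f (x + s) - f x)) =
          energy (\<lambda>x. (c k (x + s) - f (x + s)) - (c k x - f x))" by (simp add: algebra_simps)
      also have "\<dots> \<le> 2 * energy (\<lambda>x. c k (x + s) - f (x + s)) + 2 * energy (\<lambda>x. c k x - f x)"
        by (rule energy_diff_le2) measurable
      also have "energy (\<lambda>x. c k (x + s) - f (x + s)) = energy (\<lambda>x. c k x - f x)"
        by (rule energy_translate[where f = "\<lambda>x. c k x - f x"]) measurable
      finally show "energy (\<lambda>x. (c k (x + s) - c k x) - (f (x + s) - f x)) \<le>
          2 * energy (\<lambda>x. c k x - f x) + 2 * energy (\<lambda>x. c k x - f x)" .
    qed
    show "(\<lambda>m. energy (\<lambda>w. (rot (- (s \<bullet> w)) (ft (c m) w) - ft (c m) w) - (rot (- (s \<bullet> w)) (g w) - g w))) \<longlonglongrightarrow> 0"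
    proof (rule tendsto_0_of_le[OF ft_lim])
      fix k
      have "energy (\<lambda>w. (rot (- (s \<bullet> w)) (ft (c k) w) - ft (c k) w) - (rot (- (s \<bullet> w)) (g w) - g w)) =
          energy (\<lambda>w. rot (- (s \<bullet> w)) (ft (c k) w - g w) - (ft (c k) w - g w))"
        by (simp add: rot_diff algebra_simps)
      also have "\<dots> \<le> 2 * energy (\<lambda>w. rot (- (s \<bullet> w)) (ft (c k) w - g w)) + 2 * energy (\<lambda>w. ft (c k) w - g w)"
        by (rule energy_diff_le2) measurable
      also have "energy (\<lambda>w. rot (- (s \<bullet> w)) (ft (c k) w - g w)) = energy (\<lambda>w. ft (c k) w - g w)"
        by (simp add: energy_def)
      finally show "energy (\<lambda>w. (rot (- (s \<bullet> w)) (ft (c k) w) - ft (c k) w) - (rot (- (s \<bullet> w)) (g w) - g w)) \<le>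
          2 * energy (\<lambda>w. ft (c k) w - g w) + 2 * energy (\<lambda>w. ft (c k) w - g w)" .
    qed
  qed auto
qed

end


section \<open>The uncertainty principle\<close>

text \<open>
  The quadratic \<open>B \<mu>\<^sup>2 / 2 - X \<mu> + 2 A\<close> is nonnegative for \<open>\<mu> > 0\<close>, so its discriminant is at most 0.
\<close>

lemma sq_le_of_forall_quadratic:
  fixes X A B :: real
  assumes "X \<ge> 0" "A \<ge> 0" "B \<ge> 0" and le: "\<And>\<mu>. \<mu> > 0 \<Longrightarrow> X \<le> \<mu> * B / 2 + 2 * A / \<mu>"
  shows "X\<^sup>2 \<le> 4 * (A * B)"
proof (cases "X = 0")
  case False
  then have X: "X > 0" using assms by simp
  show ?thesis
  proof (cases "B = 0")
    case True
    have "X \<le> 2 * A / ((2 * A + 1) / X)"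
      using le[of "(2 * A + 1) / X"] X assms True by simp
    also have "\<dots> = X * (2 * A / (2 * A + 1))" by simp
    also have "\<dots> < X * 1"
      using X assms by (intro mult_strict_left_mono) auto
    finally show ?thesis by simp
  next
    case False
    then have B: "B > 0" using assms by simp
    have "X \<le> X / 2 + 2 * A * B / X"
      using le[of "X / B"] X B by (simp add: mult_ac)
    then have "X / 2 * X \<le> 2 * A * B"
      using X by (simp add: field_simps)
    then show ?thesis by (simp add: power2_eq_square)
  qed
qed (use assms in simp)

text \<open>
  The uncertainty inequality with the frequency factor replaced by a bound for difference
  quotients. With \<open>\<kappa> = \<alpha> \<bullet> \<beta>\<close>, moving the origin by \<open>t \<beta>\<close> changes the first moment \<open>M\<close> of \<open>|f|\<^sup>2\<close> by
  \<open>t \<kappa> F\<close>, whereas the difference of \<open>|f|\<^sup>2\<close> and its translate is an inner product of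
  \<open>f (x + t \<beta>) - f x\<close> and \<open>f (x + t \<beta>) + f x\<close>. The Cauchy-Schwarz inequality is used in the form of
  the bounds with a free parameter \<open>\<mu>\<close>, optimized at the end by \<open>sq_le_of_forall_quadratic\<close>.
\<close>

lemma uncertainty_from_shifts:
  fixes f :: "'a::euclidean_space \<Rightarrow> 'v::euclidean_space" and \<alpha> \<beta> :: 'a
  assumes [measurable]: "f \<in> borel_measurable borel" and f: "energy f < \<infinity>"
    and A: "(\<integral>\<^sup>+x. ennreal ((\<alpha> \<bullet> x)\<^sup>2 * (norm (f x))\<^sup>2) \<partial>lborel) < \<infinity>"
    and B: "B < \<infinity>" and shift: "\<And>t. energy (\<lambda>x. f (x + t *\<^sub>R \<beta>) - f x) \<le> ennreal (t\<^sup>2) * B"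
  shows "ennreal ((\<alpha> \<bullet> \<beta>)\<^sup>2 / 4) * (energy f)\<^sup>2 \<le>
    (\<integral>\<^sup>+x. ennreal ((\<alpha> \<bullet> x)\<^sup>2 * (norm (f x))\<^sup>2) \<partial>lborel) * B"
proof -
  define \<kappa> where "\<kappa> = \<alpha> \<bullet> \<beta>"
  define F where "F = (\<integral>x. (norm (f x))\<^sup>2 \<partial>lborel)"
  define M where "M = (\<integral>x. (\<alpha> \<bullet> x) * (norm (f x))\<^sup>2 \<partial>lborel)"
  define A' where "A' = (\<integral>x. (\<alpha> \<bullet> x)\<^sup>2 * (norm (f x))\<^sup>2 \<partial>lborel)"
  define B' where "B' = enn2real B"
  have B': "B = ennreal B'" "0 \<le> B'" using B by (simp_all add: B'_def)
  note int0 = energy_eq_integral(1)[OF assms(1) f]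
  have int2: "integrable lborel (\<lambda>x. (\<alpha> \<bullet> x)\<^sup>2 * (norm (f x))\<^sup>2)"
    using A by (intro integrableI_bounded) auto
  have int1: "integrable lborel (\<lambda>x. (\<alpha> \<bullet> x) * (norm (f x))\<^sup>2)"
  proof (rule Bochner_Integration.integrable_bound[OF Bochner_Integration.integrable_add[OF int0 int2]])
    show "AE x in lborel. norm ((\<alpha> \<bullet> x) * (norm (f x))\<^sup>2) \<le>
        norm ((norm (f x))\<^sup>2 + (\<alpha> \<bullet> x)\<^sup>2 * (norm (f x))\<^sup>2)"
    proof (rule AE_I2)
      fix x
      have "\<bar>\<alpha> \<bullet> x\<bar> \<le> 1 + (\<alpha> \<bullet> x)\<^sup>2"
        using sum_squares_bound[of "\<bar>\<alpha> \<bullet> x\<bar>" 1] zero_le_power2[of "\<alpha> \<bullet> x"] abs_ge_zero[of "\<alpha> \<bullet> x"]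
        unfolding power_one power2_abs by linarith
      then have "\<bar>\<alpha> \<bullet> x\<bar> * (norm (f x))\<^sup>2 \<le> (1 + (\<alpha> \<bullet> x)\<^sup>2) * (norm (f x))\<^sup>2"
        by (rule mult_right_mono) simp
      then show "norm ((\<alpha> \<bullet> x) * (norm (f x))\<^sup>2) \<le>
        norm ((norm (f x))\<^sup>2 + (\<alpha> \<bullet> x)\<^sup>2 * (norm (f x))\<^sup>2)"
        by (simp add: abs_mult algebra_simps)
    qed
  qed measurable
  have F: "energy f = ennreal F" "0 \<le> F"
    unfolding F_def using energy_eq_integral(2)[OF assms(1) f] by auto
  have A': "(\<integral>\<^sup>+x. ennreal ((\<alpha> \<bullet> x)\<^sup>2 * (norm (f x))\<^sup>2) \<partial>lborel) = ennreal A'" "0 \<le> A'"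
    unfolding A'_def using int2 by (auto intro!: nn_integral_eq_integral)
  have amgm: "r * s \<le> (r\<^sup>2 + s\<^sup>2) / 2" for r s :: real
    using sum_squares_bound[of r s] by simp
  have main: "\<bar>\<kappa>\<bar> * F \<le> \<mu> * B' / 2 + (A' - 2 * t * \<kappa> * M + t\<^sup>2 * \<kappa>\<^sup>2 * F + A') / \<mu>"
    if \<mu>: "\<mu> > 0" and t: "t > 0" for \<mu> t
  proof -
    let ?f = "\<lambda>x. f (x + t *\<^sub>R \<beta>)"
    \<comment> \<open>integrals of the translate \<open>?f\<close> are integrals of \<open>f\<close> with the weight \<open>\<alpha> \<bullet> x - t * \<kappa>\<close>\<close>
    have shift_arg: "\<alpha> \<bullet> x = \<alpha> \<bullet> (x + t *\<^sub>R \<beta>) - t * \<kappa>" for x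
      by (simp add: inner_add_right \<kappa>_def)
    have s0: "integrable lborel (\<lambda>x. (norm (?f x))\<^sup>2)"
      using integrable_translate[OF int0] by simp
    have i1: "integrable lborel (\<lambda>x. (\<alpha> \<bullet> x - t * \<kappa>) * (norm (f x))\<^sup>2)"
      unfolding left_diff_distrib using int0 int1 by (intro Bochner_Integration.integrable_diff integrable_mult_right)
    have s1: "integrable lborel (\<lambda>x. (\<alpha> \<bullet> x) * (norm (?f x))\<^sup>2)"
      using integrable_translate[OF i1, of "t *\<^sub>R \<beta>"] by (simp flip: shift_arg)
    have e1: "(\<integral>x. (\<alpha> \<bullet> x) * (norm (?f x))\<^sup>2 \<partial>lborel) = M - t * \<kappa> * F"
    proof -
      have "(\<integral>x. (\<alpha> \<bullet> x) * (norm (?f x))\<^sup>2 \<partial>lborel) =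
          (\<integral>x. (\<alpha> \<bullet> (x + t *\<^sub>R \<beta>) - t * \<kappa>) * (norm (?f x))\<^sup>2 \<partial>lborel)"
        by (simp flip: shift_arg)
      also have "\<dots> = (\<integral>x. (\<alpha> \<bullet> x - t * \<kappa>) * (norm (f x))\<^sup>2 \<partial>lborel)"
        by (rule integral_translate[where f = "\<lambda>x. (\<alpha> \<bullet> x - t * \<kappa>) * (norm (f x))\<^sup>2"]) measurable
      also have "\<dots> = M - t * \<kappa> * F"
        unfolding left_diff_distrib M_def F_def using int0 int1 by simp
      finally show ?thesis .
    qed
    have expand: "(\<alpha> \<bullet> x - t * \<kappa>)\<^sup>2 * (norm (f x))\<^sup>2 = (\<alpha> \<bullet> x)\<^sup>2 * (norm (f x))\<^sup>2 -
        2 * t * \<kappa> * ((\<alpha> \<bullet> x) * (norm (f x))\<^sup>2) + t\<^sup>2 * \<kappa>\<^sup>2 * (norm (f x))\<^sup>2" for x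
      by (simp add: power2_eq_square algebra_simps)
    have i2: "integrable lborel (\<lambda>x. (\<alpha> \<bullet> x - t * \<kappa>)\<^sup>2 * (norm (f x))\<^sup>2)"
      unfolding expand using int0 int1 int2
      by (intro Bochner_Integration.integrable_diff Bochner_Integration.integrable_add integrable_mult_right)
    have s2: "integrable lborel (\<lambda>x. (\<alpha> \<bullet> x)\<^sup>2 * (norm (?f x))\<^sup>2)"
      using integrable_translate[OF i2, of "t *\<^sub>R \<beta>"] by (simp flip: shift_arg)
    have e2: "(\<integral>x. (\<alpha> \<bullet> x)\<^sup>2 * (norm (?f x))\<^sup>2 \<partial>lborel) = A' - 2 * t * \<kappa> * M + t\<^sup>2 * \<kappa>\<^sup>2 * F"
    proof -
      have "(\<integral>x. (\<alpha> \<bullet> x)\<^sup>2 * (norm (?f x))\<^sup>2 \<partial>lborel) =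
          (\<integral>x. (\<alpha> \<bullet> (x + t *\<^sub>R \<beta>) - t * \<kappa>)\<^sup>2 * (norm (?f x))\<^sup>2 \<partial>lborel)"
        by (simp flip: shift_arg)
      also have "\<dots> = (\<integral>x. (\<alpha> \<bullet> x - t * \<kappa>)\<^sup>2 * (norm (f x))\<^sup>2 \<partial>lborel)"
        by (rule integral_translate[where f = "\<lambda>x. (\<alpha> \<bullet> x - t * \<kappa>)\<^sup>2 * (norm (f x))\<^sup>2"]) measurable
      also have "\<dots> = A' - 2 * t * \<kappa> * M + t\<^sup>2 * \<kappa>\<^sup>2 * F"
        unfolding expand M_def F_def A'_def using int0 int1 int2 by simp
      finally show ?thesis .
    qed
    have d_fin: "energy (\<lambda>x. ?f x - f x) < \<infinity>"
      using shift[of t] by (rule le_less_trans) (simp add: B' flip: ennreal_mult)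
    have d: "integrable lborel (\<lambda>x. (norm (?f x - f x))\<^sup>2)"
      by (rule energy_eq_integral(1)[OF _ d_fin]) measurable
    have d_le: "(\<integral>x. (norm (?f x - f x))\<^sup>2 \<partial>lborel) \<le> t\<^sup>2 * B'"
    proof -
      have "energy (\<lambda>x. ?f x - f x) = ennreal (\<integral>x. (norm (?f x - f x))\<^sup>2 \<partial>lborel)"
        by (rule energy_eq_integral(2)[OF _ d_fin]) measurable
      with shift[of t] show ?thesis
        using B'(2) by (simp add: B'(1) ennreal_le_iff flip: ennreal_mult)
    qed
    have "t * \<kappa> * F = (\<integral>x. (\<alpha> \<bullet> x) * (norm (f x))\<^sup>2 - (\<alpha> \<bullet> x) * (norm (?f x))\<^sup>2 \<partial>lborel)"
      using int1 s1 by (simp add: e1 M_def)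
    then have "t * (\<bar>\<kappa>\<bar> * F) = \<bar>\<integral>x. (\<alpha> \<bullet> x) * (norm (f x))\<^sup>2 - (\<alpha> \<bullet> x) * (norm (?f x))\<^sup>2 \<partial>lborel\<bar>"
      using t F(2) by (metis abs_mult abs_of_nonneg abs_of_pos mult.assoc)
    also have "\<dots> \<le> (\<integral>x. \<bar>(\<alpha> \<bullet> x) * (norm (f x))\<^sup>2 - (\<alpha> \<bullet> x) * (norm (?f x))\<^sup>2\<bar> \<partial>lborel)"
      by (rule integral_abs_bound)
    also have "\<dots> \<le> (\<integral>x. \<mu> / t / 2 * (norm (?f x - f x))\<^sup>2 +
        t / \<mu> * ((\<alpha> \<bullet> x)\<^sup>2 * (norm (?f x))\<^sup>2 + (\<alpha> \<bullet> x)\<^sup>2 * (norm (f x))\<^sup>2) \<partial>lborel)"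
    proof (rule integral_mono)
      fix x
      \<comment> \<open>the parameter \<open>\<mu> / t\<close> compensates the factor \<open>t\<^sup>2\<close> in the shift bound, so that one power of \<open>t\<close> cancels\<close>
      let ?l = "\<mu> / t" and ?u = "norm (?f x - f x)" and ?v = "\<bar>\<alpha> \<bullet> x\<bar> * norm (?f x + f x)"
      have "(norm (f x))\<^sup>2 - (norm (?f x))\<^sup>2 = - ((?f x - f x) \<bullet> (?f x + f x))"
        by (simp add: power2_norm_eq_inner inner_diff_left inner_diff_right inner_add_left inner_add_right inner_commute)
      then have "\<bar>(\<alpha> \<bullet> x) * (norm (f x))\<^sup>2 - (\<alpha> \<bullet> x) * (norm (?f x))\<^sup>2\<bar> =
          \<bar>\<alpha> \<bullet> x\<bar> * \<bar>(?f x - f x) \<bullet> (?f x + f x)\<bar>"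
        by (simp flip: right_diff_distrib add: abs_mult)
      also have "\<dots> \<le> \<bar>\<alpha> \<bullet> x\<bar> * (?u * norm (?f x + f x))"
        by (intro mult_left_mono Cauchy_Schwarz_ineq2) simp
      also have "\<dots> = (sqrt ?l * ?u) * (?v / sqrt ?l)"
        using \<mu> t by simp
      also have "\<dots> \<le> ((sqrt ?l * ?u)\<^sup>2 + (?v / sqrt ?l)\<^sup>2) / 2"
        by (rule amgm)
      also have "\<dots> = \<mu> / t / 2 * ?u\<^sup>2 + t / \<mu> / 2 * ((\<alpha> \<bullet> x)\<^sup>2 * (norm (?f x + f x))\<^sup>2)"
        using \<mu> t by (simp add: power_mult_distrib power_divide add_divide_distrib)
      also have "\<dots> \<le> \<mu> / t / 2 * ?u\<^sup>2 + t / \<mu> / 2 * ((\<alpha> \<bullet> x)\<^sup>2 * (2 * (norm (?f x))\<^sup>2 + 2 * (norm (f x))\<^sup>2))"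
        using norm_add_sq_le[of 1 "?f x" "f x"] \<mu> t by (intro add_left_mono mult_left_mono) auto
      finally show "\<bar>(\<alpha> \<bullet> x) * (norm (f x))\<^sup>2 - (\<alpha> \<bullet> x) * (norm (?f x))\<^sup>2\<bar> \<le> \<mu> / t / 2 * ?u\<^sup>2 +
        t / \<mu> * ((\<alpha> \<bullet> x)\<^sup>2 * (norm (?f x))\<^sup>2 + (\<alpha> \<bullet> x)\<^sup>2 * (norm (f x))\<^sup>2)"
        by (simp add: algebra_simps)
    qed (intro integrable_abs Bochner_Integration.integrable_diff Bochner_Integration.integrable_add
          integrable_mult_right int1 s1 d s2 int2)+
    also have "\<dots> = \<mu> / t / 2 * (\<integral>x. (norm (?f x - f x))\<^sup>2 \<partial>lborel) +
        t / \<mu> * (A' - 2 * t * \<kappa> * M + t\<^sup>2 * \<kappa>\<^sup>2 * F + A')"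
      using d s2 int2 by (simp add: e2 A'_def)
    also have "\<dots> \<le> \<mu> / t / 2 * (t\<^sup>2 * B') + t / \<mu> * (A' - 2 * t * \<kappa> * M + t\<^sup>2 * \<kappa>\<^sup>2 * F + A')"
      using \<mu> t by (intro add_right_mono mult_left_mono d_le) auto
    also have "\<dots> = t * (\<mu> * B' / 2 + (A' - 2 * t * \<kappa> * M + t\<^sup>2 * \<kappa>\<^sup>2 * F + A') / \<mu>)"
      using \<mu> t by (simp add: field_simps power2_eq_square)
    finally show ?thesis using t by simp
  qed
  have "\<bar>\<kappa>\<bar> * F \<le> \<mu> * B' / 2 + 2 * A' / \<mu>" if \<mu>: "\<mu> > 0" for \<mu>
  proof -
    have "((\<lambda>t. \<mu> * B' / 2 + (A' - 2 * t * \<kappa> * M + t\<^sup>2 * \<kappa>\<^sup>2 * F + A') / \<mu>) \<longlongrightarrow>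
        \<mu> * B' / 2 + (A' - 2 * 0 * \<kappa> * M + 0\<^sup>2 * \<kappa>\<^sup>2 * F + A') / \<mu>) (at_right 0)"
      using \<mu> by (intro tendsto_intros) auto
    then have "\<bar>\<kappa>\<bar> * F \<le> \<mu> * B' / 2 + (A' - 2 * 0 * \<kappa> * M + 0\<^sup>2 * \<kappa>\<^sup>2 * F + A') / \<mu>"
      by (rule tendsto_lowerbound)
        (use main[OF \<mu>] in \<open>auto simp: eventually_at_right_less intro!: eventually_mono[OF eventually_at_right_less]\<close>)
    then show ?thesis by simp
  qed
  then have "(\<bar>\<kappa>\<bar> * F)\<^sup>2 \<le> 4 * (A' * B')"
    using F A' B' by (intro sq_le_of_forall_quadratic) auto
  then have "\<kappa>\<^sup>2 / 4 * F\<^sup>2 \<le> A' * B'" by (simp add: power_mult_distrib)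
  then show ?thesis
    unfolding F(1) A'(1) B'(1) using F A' B'
    by (simp add: ennreal_leI \<kappa>_def ennreal_power flip: ennreal_mult)
qed

text \<open>
  The weight vanishes only on a hyperplane, which is a null set.
\<close>

lemma energy_eq_0_of_weighted:
  fixes g :: "'a::euclidean_space \<Rightarrow> 'v::euclidean_space"
  assumes [measurable]: "g \<in> borel_measurable borel" and "\<beta> \<noteq> 0"
    and 0: "(\<integral>\<^sup>+w. ennreal ((\<beta> \<bullet> w)\<^sup>2 * (norm (g w))\<^sup>2) \<partial>lborel) = 0"
  shows "energy g = 0"
proof -
  have "AE w in lborel. ennreal ((\<beta> \<bullet> w)\<^sup>2 * (norm (g w))\<^sup>2) = 0"
    using 0 by (subst (asm) nn_integral_0_iff_AE) auto
  moreover have "AE w in lborel. \<beta> \<bullet> w \<noteq> 0"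
  proof -
    have "{w. \<beta> \<bullet> w = 0} \<in> null_sets lebesgue"
      using negligible_hyperplane[of \<beta> 0] \<open>\<beta> \<noteq> 0\<close> by (simp add: negligible_iff_null_sets)
    from AE_not_in[OF this] show ?thesis by (simp add: AE_completion_iff)
  qed
  ultimately have "AE w in lborel. g w = 0"
    by eventually_elim (auto simp: ennreal_eq_0_iff mult_le_0_iff power2_eq_square)
  then show ?thesis using energy_cong_AE[of g "\<lambda>_. 0"] by (simp add: energy_def)
qed

text \<open>
  If both factors on the right are finite, \<open>uncertainty_from_shifts\<close> applies. Otherwise the right-hand
  side is infinite unless one of the factors is 0, and then \<open>f\<close> or its transform is 0, unless
  \<open>\<alpha>\<close> or \<open>\<beta>\<close> is.
\<close>

theorem (in complex_structure) uncertainty: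
  fixes f g :: "'a::euclidean_space \<Rightarrow> 'v" and \<alpha> \<beta> :: 'a
  assumes [measurable]: "f \<in> borel_measurable borel" "g \<in> borel_measurable borel"
    and f: "energy f < \<infinity>" and ft: "is_ft_L2 f g"
  shows "ennreal ((\<alpha> \<bullet> \<beta>)\<^sup>2 / 4) * (energy f)\<^sup>2 \<le>
    (\<integral>\<^sup>+x. ennreal ((\<alpha> \<bullet> x)\<^sup>2 * (norm (f x))\<^sup>2) \<partial>lborel) *
    (ennreal (1 / (2 * pi) ^ DIM('a)) * (\<integral>\<^sup>+w. ennreal ((\<beta> \<bullet> w)\<^sup>2 * (norm (g w))\<^sup>2) \<partial>lborel))"
    (is "?L \<le> ?A * (?C * ?W)")
proof -
  have C: "?C \<noteq> 0" "?C < \<infinity>" by (simp_all add: ennreal_eq_0_iff not_le)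
  consider "\<alpha> = 0 \<or> \<beta> = 0" | "energy f = 0" | "?A < \<infinity>" "?C * ?W < \<infinity>" |
    "?A * (?C * ?W) = \<infinity>"
  proof (cases "\<alpha> = 0 \<or> \<beta> = 0 \<or> energy f = 0")
    case False
    have A: "?A \<noteq> 0" using energy_eq_0_of_weighted[OF assms(1)] False by blast
    have "?W \<noteq> 0"
    proof
      assume "?W = 0"
      then have "energy g = 0" using energy_eq_0_of_weighted[OF assms(2)] False by blast
      with energy_le_ft_L2[OF assms] False show False by simp
    qed
    then have CW: "?C * ?W \<noteq> 0" using C by simp
    have "a < \<infinity> \<and> b < \<infinity> \<or> a * b = \<infinity>" if "a \<noteq> 0" "b \<noteq> 0" for a b :: ennreal
      using that by (auto simp: ennreal_mult_eq_top_iff less_top[symmetric])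
    from this[OF A CW] show thesis using that(3,4) by blast
  qed blast
  then show ?thesis
  proof cases
    case 3
    show ?thesis
    proof (rule uncertainty_from_shifts[OF assms(1) f 3])
      fix t
      have "energy (\<lambda>x. f (x + t *\<^sub>R \<beta>) - f x) \<le> ?C * energy (\<lambda>w. rot (- (t *\<^sub>R \<beta> \<bullet> w)) (g w) - g w)"
        by (rule energy_shift_le_ft_L2[OF assms])
      also have "energy (\<lambda>w. rot (- (t *\<^sub>R \<beta> \<bullet> w)) (g w) - g w) \<le>
          (\<integral>\<^sup>+w. ennreal (t\<^sup>2) * ennreal ((\<beta> \<bullet> w)\<^sup>2 * (norm (g w))\<^sup>2) \<partial>lborel)"
        unfolding energy_def
      proof (rule nn_integral_mono)
        fix w
        have "(norm (rot (- (t *\<^sub>R \<beta> \<bullet> w)) (g w) - g w))\<^sup>2 \<le> t\<^sup>2 * ((\<beta> \<bullet> w)\<^sup>2 * (norm (g w))\<^sup>2)"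
          using norm_rot_diff_sq[of "- (t *\<^sub>R \<beta> \<bullet> w)" "g w"] by (simp add: power_mult_distrib mult.assoc)
        then show "ennreal ((norm (rot (- (t *\<^sub>R \<beta> \<bullet> w)) (g w) - g w))\<^sup>2) \<le>
            ennreal (t\<^sup>2) * ennreal ((\<beta> \<bullet> w)\<^sup>2 * (norm (g w))\<^sup>2)"
          by (simp add: ennreal_leI flip: ennreal_mult)
      qed
      also have "\<dots> = ennreal (t\<^sup>2) * ?W" by (rule nn_integral_cmult) measurable
      finally show "energy (\<lambda>x. f (x + t *\<^sub>R \<beta>) - f x) \<le> ennreal (t\<^sup>2) * (?C * ?W)"
        by (simp add: mult_left_mono mult.left_commute)
    qed
  qed auto
qed


section \<open>The Clifford Fourier transform\<close>

lemma cl_sign_sq: "cl_sign p A B * cl_sign p A B = 1"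
proof -
  define m P where "m = card {(i, j). i \<in> A \<and> j \<in> B \<and> j < i}" and "P = (\<Prod>k\<in>A \<inter> B. cl_eps p k)"
  have "cl_sign p A B * cl_sign p A B = ((-1) ^ m * (-1) ^ m) * (P * P)"
    unfolding cl_sign_def m_def P_def by (simp only: mult_ac)
  also have "P * P = 1"
    unfolding P_def by (simp flip: prod.distrib)
  finally show ?thesis by (simp only: minus_one_mult_self mult_1)
qed

lemma cl_rev_nth: "cl_rev p N $ A = cl_sign p A A * N $ A"
proof -
  have "N $ A = cl_rev p N $ A * cl_sign p A A"
    using cl_scalar_rev[of p "cl_basis A" N] cl_scalar_coords[of p "cl_basis A" "cl_rev p N"]
    by (simp add: cl_basis_nth if_distrib[of "\<lambda>x. x * _"] cong: if_cong)
  then have "cl_sign p A A * N $ A = (cl_sign p A A * cl_sign p A A) * cl_rev p N $ A"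
    by (simp only: mult_ac)
  then show ?thesis by (simp only: cl_sign_sq mult_1)
qed

lemma cl_mult_inner:
  "cl_mult p M N \<bullet> L = (\<Sum>B\<in>UNIV. \<Sum>A\<in>UNIV. M $ A * N $ B * cl_sign p A B * L $ sym_diff A B)"
proof -
  have "cl_basis A \<bullet> L = L $ A" for A
    by (simp add: cl_basis_def inner_axis' inner_real_def)
  then show ?thesis
    unfolding cl_mult_def inner_sum_left inner_scaleR_left by (subst sum.swap) simp
qed

text \<open>
  On basis elements, \<open>e\<^sub>A e\<^sub>B\<close> and \<open>e\<^sub>A\<^sub>+\<^sub>B e\<^sub>B\<close> (with \<open>A + B\<close> the symmetric difference) are multiples of
  each other's first factor; the cocycle identity shows that the two signs differ exactly by the sign
  of \<open>e\<^sub>B e\<^sub>B\<close>, which is also the sign that the principal reverse gives to \<open>e\<^sub>B\<close>.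
\<close>

lemma cl_mult_adjoint: "cl_mult p M N \<bullet> L = M \<bullet> cl_mult p L (cl_rev p N)"
proof -
  have "(\<Sum>A\<in>UNIV. M $ A * N $ B * cl_sign p A B * L $ sym_diff A B) =
      (\<Sum>A\<in>UNIV. L $ A * cl_rev p N $ B * cl_sign p A B * M $ sym_diff A B)" for B
  proof (rule sum.reindex_bij_witness[where i = "\<lambda>A. sym_diff A B" and j = "\<lambda>A. sym_diff A B"])
    fix A
    show "sym_diff (sym_diff A B) B = A" "sym_diff (sym_diff A B) B = A" by auto
    have "cl_sign p B B = cl_sign p A B * cl_sign p (sym_diff A B) B"
      using cl_sign_cocycle[of p A B B] by (simp add: cl_sign_def)
    then have "cl_sign p (sym_diff A B) B * cl_sign p B B =
        cl_sign p A B * (cl_sign p (sym_diff A B) B * cl_sign p (sym_diff A B) B)"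
      by (simp only: mult_ac)
    then have "cl_sign p (sym_diff A B) B * cl_sign p B B = cl_sign p A B"
      by (simp only: cl_sign_sq mult_1_right)
    moreover have "sym_diff (sym_diff A B) B = A" by auto
    ultimately show "L $ sym_diff A B * cl_rev p N $ B * cl_sign p (sym_diff A B) B * M $ sym_diff (sym_diff A B) B =
        M $ A * N $ B * cl_sign p A B * L $ sym_diff A B"
      by (simp add: cl_rev_nth mult_ac del: Un_iff)
  qed auto
  then show ?thesis by (simp add: cl_mult_inner inner_commute[of M])
qed

lemma complex_structure_cl_mult:
  assumes "cl_mult p i i = - cl_one" and "cl_rev p i = - i"
  shows "complex_structure (\<lambda>M. cl_mult p M i)"
proof (rule complex_structure.intro)
  have neg: "cl_mult p M (- N) = - cl_mult p M N" for M N
    by (rule linear_neg[OF linear_cl_mult_right])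
  show "linear (\<lambda>M. cl_mult p M i)" by (rule linear_cl_mult_left)
  show "cl_mult p (cl_mult p v i) i = - v" for v
    by (simp add: cl_mult_assoc assms(1) neg cl_mult_one_right)
  show "cl_mult p u i \<bullet> v = - (u \<bullet> cl_mult p v i)" for u v
    by (simp add: cl_mult_adjoint assms(2) neg)
qed

text \<open>
  Fubini's theorem for the correlations of \<open>f\<close> needs \<open>(x, y) \<mapsto> f (x + y)\<close> to be measurable for the
  product, which holds for Borel but not for all Lebesgue measurable functions. Passing to an almost everywhere
  equal Borel function changes none of the integrals.
\<close>

lemma lebesgue_borel_representative:
  fixes f :: "'a::euclidean_space \<Rightarrow> 'b::euclidean_space"
  assumes f: "f \<in> borel_measurable lebesgue"
  shows "\<exists>f'\<in>borel_measurable borel. AE x in lborel. f x = f' x"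
proof -
  have "\<exists>g. g \<in> borel_measurable borel \<and> (AE x in lborel. f x \<bullet> b = g x)" for b
    using completion_ex_borel_measurable_real[of "\<lambda>x. f x \<bullet> b" lborel] f by auto
  then obtain g where g_meas: "\<And>b. g b \<in> borel_measurable borel"
    and g: "\<And>b. AE x in lborel. f x \<bullet> b = g b x"
    by metis
  note g_meas[measurable]
  have "AE x in lborel. \<forall>b\<in>Basis. f x \<bullet> b = g b x"
    by (intro AE_finite_allI) (auto simp: g)
  then have "AE x in lborel. f x = (\<Sum>b\<in>Basis. g b x *\<^sub>R b)"
  proof eventually_elim
    case (elim x)
    then have "(\<Sum>b\<in>Basis. g b x *\<^sub>R b) = (\<Sum>b\<in>Basis. (f x \<bullet> b) *\<^sub>R b)"
      by (intro sum.cong) auto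
    then show ?case by (simp add: euclidean_representation)
  qed
  then show ?thesis by (intro bexI[of _ "\<lambda>x. \<Sum>b\<in>Basis. g b x *\<^sub>R b"]) measurable
qed

lemma nn_integral_modulus:
  "(\<integral>\<^sup>+x. ennreal ((cl_modulus p (f x))\<^sup>2) \<partial>lebesgue) = energy f"
  by (simp add: cl_modulus_eq_norm energy_def nn_integral_completion)

lemma cl_L2_iff: "f \<in> cl_L2 p \<longleftrightarrow> f \<in> borel_measurable lebesgue \<and> energy f < \<infinity>"
  by (simp add: cl_L2_def nn_integral_modulus)

lemma cl_L2_tendsto_iff: "cl_L2_tendsto p h f \<longleftrightarrow> (\<lambda>m. energy (\<lambda>x. h m x - f x)) \<longlonglongrightarrow> 0"
  by (simp add: cl_L2_tendsto_def nn_integral_modulus)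

lemma cl_L2_tendsto_cong_AE:
  assumes "\<And>m. AE x in lborel. h m x = h' m x" "AE x in lborel. f x = f' x"
  shows "cl_L2_tendsto p h f \<longleftrightarrow> cl_L2_tendsto p h' f'"
proof -
  have "energy (\<lambda>x. h m x - f x) = energy (\<lambda>x. h' m x - f' x)" for m
    by (rule energy_cong_AE) (use assms(1)[of m] assms(2) in eventually_elim, simp)
  then show ?thesis by (simp add: cl_L2_tendsto_iff)
qed

lemma cl_fourier_eq_ft:
  assumes i: "cl_mult p i i = - cl_one" "cl_rev p i = - i"
    and [measurable]: "h \<in> borel_measurable lebesgue" "h' \<in> borel_measurable borel"
    and ae: "AE x in lborel. h x = h' x"
  shows "cl_fourier p i h w = complex_structure.ft (\<lambda>M. cl_mult p M i) h' w"
proof -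
  interpret complex_structure "\<lambda>M. cl_mult p M i" by (rule complex_structure_cl_mult[OF i])
  have rot: "cl_mult p M (cl_exp_neg i \<theta>) = rot \<theta> M" for M \<theta>
    by (simp add: cl_exp_neg_def rot_def linear_diff[OF linear_cl_mult_right]
        linear_scale[OF linear_cl_mult_right] cl_mult_one_right)
  have inner: "cl_scalar p (cl_vec p x) (cl_rev p (cl_vec p w)) = x \<bullet> w" for x
    by (simp add: cl_scalar_vec_rev inner_vec_def)
  have integrand: "(\<lambda>x. rot (x \<bullet> w) (h' x)) \<in> borel_measurable lborel" by measurable
  have [measurable]: "(\<lambda>x. x) \<in> borel_measurable lebesgue" "h' \<in> borel_measurable lebesgue"
    by (auto intro: measurable_completion)
  have "cl_fourier p i h w = (\<integral>x. rot (x \<bullet> w) (h x) \<partial>lebesgue)"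
    by (simp add: cl_fourier_def rot inner)
  also have "\<dots> = (\<integral>x. rot (x \<bullet> w) (h' x) \<partial>lebesgue)"
  proof (rule integral_cong_AE)
    show "AE x in lebesgue. rot (x \<bullet> w) (h x) = rot (x \<bullet> w) (h' x)"
      using AE_completion[OF ae] by eventually_elim simp
  qed measurable
  also have "\<dots> = ft h' w"
    unfolding ft_def by (rule integral_completion[OF integrand])
  finally show ?thesis .
qed

text \<open>
  The two notions of transform on \<open>L\<^sup>2\<close> differ only in the class of approximating sequences: Lebesgue
  measurable ones for \<open>is_cl_fourier_L2\<close>, Borel measurable ones for \<open>is_ft_L2\<close>. Hence this direction
  restricts the class, while the converse below replaces each member by a Borel representative.
\<close>

lemma is_cl_fourier_L2_imp_is_ft_L2:
  assumes i: "cl_mult p i i = - cl_one" "cl_rev p i = - i"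
    and f: "AE x in lborel. f x = f' x" and g: "AE x in lborel. g x = g' x"
    and F: "is_cl_fourier_L2 p i f g"
  shows "complex_structure.is_ft_L2 (\<lambda>M. cl_mult p M i) f' g'"
proof -
  interpret complex_structure "\<lambda>M. cl_mult p M i" by (rule complex_structure_cl_mult[OF i])
  show ?thesis
    unfolding is_ft_L2_def
  proof (intro allI impI)
    fix h assume h: "\<forall>m. integrable lborel (h m) \<and> energy (h m) < \<infinity>"
      and lim: "(\<lambda>m::nat. energy (\<lambda>x. h m x - f' x)) \<longlonglongrightarrow> 0"
    have [measurable]: "h m \<in> borel_measurable borel" for m
      using h borel_measurable_integrable[of lborel "h m"] by simp
    have hL: "h m \<in> borel_measurable lebesgue" for m by (rule measurable_completion) measurable
    have "integrable lebesgue (h m) \<and> h m \<in> cl_L2 p" for m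
      using h hL by (auto simp: integrable_completion cl_L2_iff)
    moreover have "cl_L2_tendsto p h f"
      using lim cl_L2_tendsto_cong_AE[where h = h and h' = h and f = f and f' = f'] f by (simp add: cl_L2_tendsto_iff)
    ultimately have "cl_L2_tendsto p (\<lambda>m. cl_fourier p i (h m)) g"
      using F by (simp add: is_cl_fourier_L2_def)
    moreover have "cl_fourier p i (h m) = ft (h m)" for m
      by (rule ext, rule cl_fourier_eq_ft[OF i hL]) auto
    ultimately have "cl_L2_tendsto p (\<lambda>m. ft (h m)) g" by simp
    then have "cl_L2_tendsto p (\<lambda>m. ft (h m)) g'"
      using g cl_L2_tendsto_cong_AE[where h = "\<lambda>m. ft (h m)" and h' = "\<lambda>m. ft (h m)" and f = g and f' = g'] by simp
    then show "(\<lambda>m. energy (\<lambda>w. ft (h m) w - g' w)) \<longlonglongrightarrow> 0" by (simp add: cl_L2_tendsto_iff)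
  qed
qed

lemma is_ft_L2_imp_is_cl_fourier_L2:
  assumes i: "cl_mult p i i = - cl_one" "cl_rev p i = - i"
    and f: "AE x in lborel. f x = f' x"
    and g: "g \<in> borel_measurable borel" "energy g < \<infinity>"
    and F: "complex_structure.is_ft_L2 (\<lambda>M. cl_mult p M i) f' g"
  shows "is_cl_fourier_L2 p i f g"
proof -
  interpret complex_structure "\<lambda>M. cl_mult p M i" by (rule complex_structure_cl_mult[OF i])
  show ?thesis
    unfolding is_cl_fourier_L2_def
  proof (intro conjI allI impI)
    show "g \<in> cl_L2 p" using g by (auto simp: cl_L2_iff intro: measurable_completion)
    fix h assume "(\<forall>m. integrable lebesgue (h m) \<and> h m \<in> cl_L2 p) \<and> cl_L2_tendsto p h f"
    then have h: "\<And>m. integrable lebesgue (h m)" "\<And>m. h m \<in> cl_L2 p" and lim: "cl_L2_tendsto p h f"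
      by auto
    have hL: "h m \<in> borel_measurable lebesgue" for m using h(2)[of m] by (simp add: cl_L2_iff)
    obtain h' where h'[measurable]: "\<And>m. h' m \<in> borel_measurable borel" and ae: "\<And>m. AE x in lborel. h m x = h' m x"
      using lebesgue_borel_representative[OF hL] by metis
    have "integrable lborel (h' m) \<and> energy (h' m) < \<infinity>" for m
    proof
      have h'L: "h' m \<in> borel_measurable lebesgue" by (rule measurable_completion) measurable
      have "integrable lebesgue (h' m)"
        using h(1)[of m] integrable_cong_AE[OF hL h'L AE_completion[OF ae]] by simp
      then show "integrable lborel (h' m)" by (simp add: integrable_completion)
      show "energy (h' m) < \<infinity>" using h(2)[of m] energy_cong_AE[OF ae] by (simp add: cl_L2_iff)
    qed
    moreover have "(\<lambda>m. energy (\<lambda>x. h' m x - f' x)) \<longlonglongrightarrow> 0"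
      using lim cl_L2_tendsto_cong_AE[OF ae f] by (simp add: cl_L2_tendsto_iff)
    ultimately have "(\<lambda>m. energy (\<lambda>w. ft (h' m) w - g w)) \<longlonglongrightarrow> 0"
      using F by (simp add: is_ft_L2_def)
    moreover have "cl_fourier p i (h m) = ft (h' m)" for m
      by (rule ext, rule cl_fourier_eq_ft[OF i hL h' ae])
    ultimately show "cl_L2_tendsto p (\<lambda>m. cl_fourier p i (h m)) g"
      by (simp add: cl_L2_tendsto_iff)
  qed
qed

theorem theorem4p1:
  fixes p q :: nat
    and i :: "'n::{finite,linorder} clifford"
    and f :: "'n rvec \<Rightarrow> 'n clifford"
    and F :: ennreal
    and a b :: "'n rvec"
  assumes "CARD('n) = p + q"
    and "cl_mult p i i = - cl_one"
    and "cl_rev p i = - i"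
    and "f \<in> cl_L2 p"
    and "F = (\<integral>\<^sup>+x. ennreal ((cl_modulus p (f x))\<^sup>2) \<partial>lebesgue)"
  shows "(\<integral>\<^sup>+x. ennreal ((cl_scalar p (cl_vec p a) (cl_vec p x))\<^sup>2 * (cl_modulus p (f x))\<^sup>2) \<partial>lebesgue)
      * (ennreal (1 / (2 * pi) ^ CARD('n)) *
         (\<integral>\<^sup>+w. ennreal ((cl_scalar p (cl_vec p b) (cl_vec p w))\<^sup>2 *
                        (cl_modulus p (cl_fourier_L2 p i f w))\<^sup>2) \<partial>lebesgue))
    \<ge> ennreal ((cl_scalar p (cl_vec p a) (cl_rev p (cl_vec p b)))\<^sup>2 * (1 / 4)) * F\<^sup>2"
proof -
  note i = assms(2,3)
  interpret complex_structure "\<lambda>M. cl_mult p M i" by (rule complex_structure_cl_mult[OF i])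
  define g where "g = cl_fourier_L2 p i f"
  have fL: "f \<in> borel_measurable lebesgue" and f_fin: "energy f < \<infinity>"
    using assms(4) by (simp_all add: cl_L2_iff)
  obtain f' where f'[measurable]: "f' \<in> borel_measurable borel" and ff': "AE x in lborel. f x = f' x"
    using lebesgue_borel_representative[OF fL] by blast
  have f'_fin: "energy f' < \<infinity>" using f_fin energy_cong_AE[OF ff'] by simp
  have "\<exists>g. is_cl_fourier_L2 p i f g"
    using ft_L2_exists[OF f' f'_fin] is_ft_L2_imp_is_cl_fourier_L2[OF i ff'] by blast
  then have g: "is_cl_fourier_L2 p i f g"
    unfolding g_def cl_fourier_L2_def by (rule someI_ex)
  then have "g \<in> borel_measurable lebesgue" by (simp add: is_cl_fourier_L2_def cl_L2_iff)
  then obtain g' where g'[measurable]: "g' \<in> borel_measurable borel" and gg': "AE x in lborel. g x = g' x"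
    using lebesgue_borel_representative by blast
  \<comment> \<open>\<open>flip c\<close> has the upper coordinates of \<open>c\<close>\<close>
  define flip where "flip = (\<lambda>c::'n rvec. \<chi> l. cl_eps p l * c $ l)"
  have lower: "cl_scalar p (cl_vec p c) (cl_vec p x) = flip c \<bullet> x" for c x
    by (simp add: cl_scalar_vec flip_def inner_vec_def)
  have "flip a \<bullet> flip b = (\<Sum>l\<in>UNIV. (cl_eps p l * cl_eps p l) * (a $ l * b $ l))"
    unfolding flip_def inner_vec_def inner_real_def vec_lambda_beta by (simp only: mult_ac)
  then have ab: "cl_scalar p (cl_vec p a) (cl_rev p (cl_vec p b)) = flip a \<bullet> flip b"
    by (simp only: cl_scalar_vec_rev cl_eps_square mult_1)
  have weighted: "(\<integral>\<^sup>+x. ennreal ((cl_scalar p (cl_vec p c) (cl_vec p x))\<^sup>2 * (cl_modulus p (u x))\<^sup>2) \<partial>lebesgue) =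
      (\<integral>\<^sup>+x. ennreal ((flip c \<bullet> x)\<^sup>2 * (norm (u' x))\<^sup>2) \<partial>lborel)"
    if "AE x in lborel. u x = u' x" for c :: "'n rvec" and u u' :: "'n rvec \<Rightarrow> 'n clifford"
    unfolding lower cl_modulus_eq_norm nn_integral_completion
    by (rule nn_integral_cong_AE, use that in eventually_elim) simp
  have "F = energy f'"
    using assms(5) energy_cong_AE[OF ff'] by (simp add: nn_integral_modulus)
  moreover have "ennreal ((flip a \<bullet> flip b)\<^sup>2 / 4) * (energy f')\<^sup>2 \<le>
    (\<integral>\<^sup>+x. ennreal ((flip a \<bullet> x)\<^sup>2 * (norm (f' x))\<^sup>2) \<partial>lborel) *
    (ennreal (1 / (2 * pi) ^ DIM('n rvec)) * (\<integral>\<^sup>+w. ennreal ((flip b \<bullet> w)\<^sup>2 * (norm (g' w))\<^sup>2) \<partial>lborel))"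
    by (rule uncertainty[OF f' g' f'_fin is_cl_fourier_L2_imp_is_ft_L2[OF i ff' gg' g]])
  ultimately show ?thesis
    unfolding ab weighted[OF ff'] weighted[OF gg', unfolded g_def] by simp
qed

end
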